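(* Fix $d\ge2$ and the relation base $\mathbb P^m$. Let $\pi,\pi'$ be profiles consisting of distinct nonempty aperiodic necklace types, each of the two profiles containing the singleton necklace. Suppose every type on each side has multiplicity at least $d$. Then the following are equivalent: (i) $Y_\pi$ and $Y_{\pi'}$ admit a relation-compatible image isomorphism; (ii) there is a bijection of their necklace types preserving both the necklace classes and their multiplicities.
   Context: $K$ is an algebraically closed field of characteristic zero, $\zeta\in K$ is a fixed primitive $d$th root of unity, $C_d=\mathbb Z/d\mathbb Z$. A necklace is a class of subsets of $C_d$ modulo translation; it is aperiodic if no nonidentity translation fixes a representative; the singleton necklace is the class of $\{0\}$. A profile $\pi$ is a finite collection of pairwise distinct nonempty aperiodic necklace types, represented by subsets $S_\nu\subset C_d$, with positive multiplicities $n_\nu$, $\sum_\nu n_\nu=m$ (the same $m$ for $\pi$ and $\pi'$). Put $\mathcal N_\pi=\prod_\nu\operatorname{Sym}^{n_\nu}\mathbb P^1$ and $$f_\pi:\mathcal N_\pi\to Y_\pi,\qquad([u_{\nu,i}:v_{\nu,i}])\mapsto\Big[\prod_{\nu,i}\prod_{a\in S_\nu}(v_{\nu,i}X-\zeta^au_{\nu,i}Z)\Big],$$ with $Y_\pi$ the reduced image; $f_\pi$ is the normalization of $Y_\pi$. The normalized relation map is $$\widehat q_\pi:\mathcal N_\pi\to\operatorname{Sym}^m\mathbb P^1=\mathbb P^m,\qquad([u_{\nu,i}:v_{\nu,i}])\mapsto\sum_{\nu,i}[u_{\nu,i}^d:v_{\nu,i}^d].$$ A relation-compatible image isomorphism is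 an isomorphism $\psi:Y_\pi\to Y_{\pi'}$ whose unique lift $\widetilde\psi:\mathcal N_\pi\to\mathcal N_{\pi'}$ to the normalizations satisfies $\widehat q_{\pi'}\circ\widetilde\psi=\widehat q_\pi$ (the relation base $\mathbb P^m$ is fixed). *)

theory Defs
  imports
    "HOL-Computational_Algebra.Polynomial"
    "HOL-Library.Multiset"
    "HOL-Library.FuncSet"
    "HOL-Library.Poly_Mapping"
begin

section \<open>Projective space\<close>

text \<open>
  Dimensions depend on the profile, so points of all projective spaces live in one type:
  classes of nonzero sequences modulo scalars.  The points of \<open>\<bbbP>\<^sup>N\<close> are the classes of sequences
  that vanish beyond position \<open>N\<close>.  A point \<open>[u : v]\<close> of \<open>\<bbbP>\<^sup>1\<close> has \<open>u\<close> at position 0 and \<open>v\<close> at 1.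
\<close>

definition proj_rel :: "(nat \<Rightarrow> 'a::field) \<Rightarrow> (nat \<Rightarrow> 'a) \<Rightarrow> bool" where
  "proj_rel x y \<longleftrightarrow> x \<noteq> (\<lambda>_. 0) \<and> (\<exists>c. c \<noteq> 0 \<and> y = (\<lambda>i. c * x i))"

quotient_type (overloaded) 'a proj = "nat \<Rightarrow> 'a::field" / partial: proj_rel
proof (rule part_equivpI)
  show "\<exists>x::nat \<Rightarrow> 'a. proj_rel x x"
    by (rule exI[of _ "\<lambda>_. 1"]) (auto simp: proj_rel_def fun_eq_iff intro!: exI[of _ 1])
  show "symp (proj_rel :: (nat \<Rightarrow> 'a) \<Rightarrow> _)"
  proof (rule sympI)
    fix x y :: "nat \<Rightarrow> 'a"
    assume "proj_rel x y"
    then obtain c where c: "x \<noteq> (\<lambda>_. 0)" "c \<noteq> 0" "y = (\<lambda>i. c * x i)"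
      by (auto simp: proj_rel_def)
    then have "y \<noteq> (\<lambda>_. 0)" "x = (\<lambda>i. inverse c * y i)"
      by (auto simp: fun_eq_iff)
    with c(2) show "proj_rel y x"
      unfolding proj_rel_def by (metis inverse_nonzero_iff_nonzero)
  qed
  show "transp (proj_rel :: (nat \<Rightarrow> 'a) \<Rightarrow> _)"
  proof (rule transpI)
    fix x y z :: "nat \<Rightarrow> 'a"
    assume "proj_rel x y" "proj_rel y z"
    then obtain c c' where c: "x \<noteq> (\<lambda>_. 0)" "c \<noteq> 0" "c' \<noteq> 0"
      "y = (\<lambda>i. c * x i)" "z = (\<lambda>i. c' * y i)"
      by (auto simp: proj_rel_def)
    then have "z = (\<lambda>i. (c' * c) * x i)" "c' * c \<noteq> 0"
      by (auto simp: mult.assoc)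
    with c(1) show "proj_rel x z"
      unfolding proj_rel_def by blast
  qed
qed

abbreviation pclass :: "(nat \<Rightarrow> 'a::field) \<Rightarrow> 'a proj" where
  "pclass \<equiv> abs_proj"

text \<open>\<open>pcoord p\<close> is some choice of homogeneous coordinates of \<open>p\<close>; everything below is
  independent of this choice.\<close>

abbreviation pcoord :: "'a::field proj \<Rightarrow> nat \<Rightarrow> 'a" where
  "pcoord \<equiv> rep_proj"

definition proj_space :: "nat \<Rightarrow> 'a::field proj set" where
  "proj_space N = {pclass x | x. x \<noteq> (\<lambda>_. 0) \<and> (\<forall>i>N. x i = 0)}"


section \<open>Projective varieties and regular maps\<close>

text \<open>
  A (reduced) projective variety is given by its closed points together with an embedding into a
  product of projective spaces, with factors indexed by \<open>idx\<close>.
\<close>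

record (overloaded) ('x, 'k, 'a::field) pvar =
  pts :: "'x set"
  idx :: "'k set"
  emb :: "'x \<Rightarrow> 'k \<Rightarrow> 'a proj"

text \<open>Polynomials in variables indexed by \<open>'v\<close>, as finitely supported coefficient functions on
  monomials, which are finitely supported exponent vectors.\<close>

definition peval :: "(('v \<Rightarrow>\<^sub>0 nat) \<Rightarrow>\<^sub>0 'a::comm_semiring_1) \<Rightarrow> ('v \<Rightarrow> 'a) \<Rightarrow> 'a" where
  "peval F x = (\<Sum>t\<in>Poly_Mapping.keys F. Poly_Mapping.lookup F t *
      (\<Prod>v\<in>Poly_Mapping.keys t. x v ^ Poly_Mapping.lookup t v))"

text \<open>Multihomogeneous of multidegree \<open>D\<close>; the variable \<open>(k, j)\<close> is the \<open>j\<close>-th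
  homogeneous coordinate on the \<open>k\<close>-th factor.\<close>

definition multihomogeneous ::
    "'k set \<Rightarrow> ('k \<Rightarrow> nat) \<Rightarrow> ((('k \<times> nat) \<Rightarrow>\<^sub>0 nat) \<Rightarrow>\<^sub>0 'a::zero) \<Rightarrow> bool" where
  "multihomogeneous K D F \<longleftrightarrow> (\<forall>t\<in>Poly_Mapping.keys F.
      fst ` Poly_Mapping.keys t \<subseteq> K \<and>
      (\<forall>k\<in>K. (\<Sum>v | v \<in> Poly_Mapping.keys t \<and> fst v = k. Poly_Mapping.lookup t v) = D k))"

definition form_values ::
    "('x, 'k, 'a::field) pvar \<Rightarrow> (nat \<Rightarrow> ((('k \<times> nat) \<Rightarrow>\<^sub>0 nat) \<Rightarrow>\<^sub>0 'a)) \<Rightarrow> 'x \<Rightarrow> nat \<Rightarrow> 'a" where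
  "form_values V F x = (\<lambda>i. peval (F i) (\<lambda>(k, j). pcoord (emb V x k) j))"

text \<open>
  A map is regular if near every point each of its projective components is
  \<open>[F\<^sub>0 : F\<^sub>1 : \<dots>]\<close> with multihomogeneous forms of one common multidegree.  When the
  target component lies in \<open>\<bbbP>\<^sup>N\<close>, the \<open>F\<^sub>i\<close> with \<open>i > N\<close> necessarily vanish on the source.
\<close>

definition regular_map ::
    "('x, 'k, 'a::field) pvar \<Rightarrow> ('y, 'l, 'a) pvar \<Rightarrow> ('x \<Rightarrow> 'y) \<Rightarrow> bool" where
  "regular_map V W \<phi> \<longleftrightarrow>
     \<phi> \<in> pts V \<rightarrow> pts W \<and>
     (\<forall>x\<in>pts V. \<forall>l\<in>idx W. \<exists>F D.
        (\<forall>i. multihomogeneous (idx V) D (F i)) \<and>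
        form_values V F x \<noteq> (\<lambda>_. 0) \<and>
        (\<forall>y\<in>pts V. form_values V F y \<noteq> (\<lambda>_. 0) \<longrightarrow>
            emb W (\<phi> y) l = pclass (form_values V F y)))"

definition isomorphism ::
    "('x, 'k, 'a::field) pvar \<Rightarrow> ('y, 'l, 'a) pvar \<Rightarrow> ('x \<Rightarrow> 'y) \<Rightarrow> bool" where
  "isomorphism V W \<phi> \<longleftrightarrow> regular_map V W \<phi> \<and>
     (\<exists>\<chi>. regular_map W V \<chi> \<and> (\<forall>x\<in>pts V. \<chi> (\<phi> x) = x) \<and> (\<forall>y\<in>pts W. \<phi> (\<chi> y) = y))"


section \<open>Necklaces and profiles\<close>

text \<open>\<open>C\<^sub>d\<close> is \<open>{..<d}\<close> with addition modulo \<open>d\<close>.\<close>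

definition translate :: "nat \<Rightarrow> nat \<Rightarrow> nat set \<Rightarrow> nat set" where
  "translate d t S = (\<lambda>a. (a + t) mod d) ` S"

definition necklace :: "nat \<Rightarrow> nat set \<Rightarrow> nat set set" where
  "necklace d S = {translate d t S | t. t < d}"

definition aperiodic :: "nat \<Rightarrow> nat set \<Rightarrow> bool" where
  "aperiodic d S \<longleftrightarrow> (\<forall>t<d. translate d t S = S \<longrightarrow> t = 0)"

record 'i profile =
  types :: "'i set"
  rep :: "'i \<Rightarrow> nat set"
  mult :: "'i \<Rightarrow> nat"

definition is_profile :: "nat \<Rightarrow> nat \<Rightarrow> 'i profile \<Rightarrow> bool" where
  "is_profile d m \<pi> \<longleftrightarrow>
     finite (types \<pi>) \<and>
     (\<forall>\<nu>\<in>types \<pi>. rep \<pi> \<nu> \<subseteq> {..<d} \<and> rep \<pi> \<nu> \<noteq> {} \<and> aperiodic d (rep \<pi> \<nu>) \<and> 0 < mult \<pi> \<nu>) \<and>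
     inj_on (\<lambda>\<nu>. necklace d (rep \<pi> \<nu>)) (types \<pi>) \<and>
     (\<Sum>\<nu>\<in>types \<pi>. mult \<pi> \<nu>) = m"

definition primitive_root :: "nat \<Rightarrow> 'a::field \<Rightarrow> bool" where
  "primitive_root d \<zeta> \<longleftrightarrow> \<zeta> ^ d = 1 \<and> (\<forall>k. 0 < k \<and> k < d \<longrightarrow> \<zeta> ^ k \<noteq> 1)"


section \<open>The maps attached to a profile\<close>

text \<open>
  A binary form of degree \<open>N\<close> in \<open>X, Z\<close> is represented by its dehomogenization at \<open>Z = 1\<close>: the
  \<open>i\<close>-th coefficient is the one of \<open>X\<^sup>i Z\<^sup>N\<^sup>-\<^sup>i\<close>.  \<open>orbit_form \<zeta> S p\<close> is the
  product over \<open>a \<in> S\<close> of \<open>v X - \<zeta>\<^sup>a u Z\<close> for \<open>p = [u : v]\<close>.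
\<close>

definition orbit_form :: "'a::field \<Rightarrow> nat set \<Rightarrow> 'a proj \<Rightarrow> 'a poly" where
  "orbit_form \<zeta> S p = (\<Prod>a\<in>S. [: - (\<zeta> ^ a * pcoord p 0), pcoord p 1 :])"

definition Sym_P1 :: "nat \<Rightarrow> 'a::field proj multiset set" where
  "Sym_P1 n = {M. set_mset M \<subseteq> proj_space 1 \<and> size M = n}"

text \<open>The identification of \<open>Sym\<^sup>n \<bbbP>\<^sup>1\<close> with \<open>\<bbbP>\<^sup>n\<close>, the space of binary forms of degree \<open>n\<close>.\<close>

definition Sym_coord :: "'a::field proj multiset \<Rightarrow> 'a proj" where
  "Sym_coord M = pclass (coeff (\<Prod>p\<in>#M. [: - pcoord p 0, pcoord p 1 :]))"

definition N_var :: "'i profile \<Rightarrow> ('i \<Rightarrow> 'a::field proj multiset, 'i, 'a) pvar" where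
  "N_var \<pi> = \<lparr> pts = (\<Pi>\<^sub>E \<nu>\<in>types \<pi>. Sym_P1 (mult \<pi> \<nu>)),
              idx = types \<pi>,
              emb = (\<lambda>x \<nu>. Sym_coord (x \<nu>)) \<rparr>"

definition f_map :: "'a::field \<Rightarrow> 'i profile \<Rightarrow> ('i \<Rightarrow> 'a proj multiset) \<Rightarrow> 'a proj" where
  "f_map \<zeta> \<pi> x = pclass (coeff (\<Prod>\<nu>\<in>types \<pi>. \<Prod>p\<in>#x \<nu>. orbit_form \<zeta> (rep \<pi> \<nu>) p))"

text \<open>The image lies in the single projective space of binary forms of degree \<open>\<Sum>\<^sub>\<nu> n\<^sub>\<nu> |S\<^sub>\<nu>|\<close>.\<close>

definition Y_var :: "'a::field \<Rightarrow> 'i profile \<Rightarrow> ('a proj, unit, 'a) pvar" where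
  "Y_var \<zeta> \<pi> = \<lparr> pts = f_map \<zeta> \<pi> ` pts (N_var \<pi>), idx = {()}, emb = (\<lambda>y _. y) \<rparr>"

definition power_point :: "nat \<Rightarrow> 'a::field proj \<Rightarrow> 'a proj" where
  "power_point d p = pclass (\<lambda>i. pcoord p i ^ d)"

definition q_hat :: "nat \<Rightarrow> 'i profile \<Rightarrow> ('i \<Rightarrow> 'a::field proj multiset) \<Rightarrow> 'a proj multiset" where
  "q_hat d \<pi> x = (\<Sum>\<nu>\<in>types \<pi>. image_mset (power_point d) (x \<nu>))"

text \<open>
  \<open>f_map\<close> is the normalization of its image, so an isomorphism \<open>\<psi>\<close> of the images has exactly one
  lift; hence requiring some lift to be compatible says that the unique one is.
\<close>

definition is_lift ::
    "'a::field \<Rightarrow> 'i profile \<Rightarrow> 'j profile \<Rightarrow> ('a proj \<Rightarrow> 'a proj) \<Rightarrow>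
     (('i \<Rightarrow> 'a proj multiset) \<Rightarrow> ('j \<Rightarrow> 'a proj multiset)) \<Rightarrow> bool" where
  "is_lift \<zeta> \<pi> \<pi>' \<psi> \<psi>t \<longleftrightarrow> regular_map (N_var \<pi>) (N_var \<pi>') \<psi>t \<and>
     (\<forall>x\<in>pts (N_var \<pi>). f_map \<zeta> \<pi>' (\<psi>t x) = \<psi> (f_map \<zeta> \<pi> x))"

definition relation_compatible_iso ::
    "nat \<Rightarrow> 'a::field \<Rightarrow> 'i profile \<Rightarrow> 'j profile \<Rightarrow> ('a proj \<Rightarrow> 'a proj) \<Rightarrow> bool" where
  "relation_compatible_iso d \<zeta> \<pi> \<pi>' \<psi> \<longleftrightarrow>
     isomorphism (Y_var \<zeta> \<pi>) (Y_var \<zeta> \<pi>') \<psi> \<and>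
     (\<exists>\<psi>t. is_lift \<zeta> \<pi> \<pi>' \<psi> \<psi>t \<and> (\<forall>x\<in>pts (N_var \<pi>). q_hat d \<pi>' (\<psi>t x) = q_hat d \<pi> x))"

end

theory Submission
  imports Defs
begin

text \<open>
  From (ii) to (i): two representatives of one necklace differ by a translation by some \<open>t\<close>, and
  replacing \<open>S\<close> by \<open>S + t\<close> is undone by the coordinate change \<open>[u : v] \<mapsto> [u : \<zeta>\<^sup>t v]\<close>.
  This change is linear in the coefficients of binary forms and invisible after \<open>d\<close>-th powers.
  Hence the two images are the same subvariety, the identity is an isomorphism between
  them, and its lift rotates each factor (\<open>rotation_lift\<close>).

  From (i) to (ii), the first step is a rigidity statement.  Label the points of
  \<open>x \<in> \<N>\<^sub>\<pi>\<close> by slots and let all of them be affine, with coordinates \<open>u\<^sub>i\<close>.  Compatibility with the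
  relation maps forces the lift to send \<open>x\<close> to a redistribution of points \<open>\<zeta>\<^sup>e\<^sup>(\<^sup>i\<^sup>) u\<^sub>i\<close>
  among the types of \<open>\<pi>'\<close>.  There are finitely many ways to do this, so along a line
  in \<open>u\<close>-space one of them occurs infinitely often; being given by polynomials on
  the line, it then holds on the whole line.  All lines through a base point whose coordinates have distinct
  nonzero \<open>d\<close>-th powers must carry the same redistribution, since it can be read off at that
  point.  So a slot \<open>i\<close> goes to a fixed type \<open>\<tau> i\<close> with a fixed
  rotation \<open>e i\<close>, for all \<open>u\<close> (\<open>lift_rigid\<close>).

  The second step uses that \<open>\<psi>\<close> is a function: two configurations with equal image under \<open>f\<^sub>\<pi>\<close>
  have lifts with equal image under \<open>f\<^sub>\<pi>\<^sub>'\<close>.  Write \<open>E\<^sub>i\<close> for the multiset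
  of the \<open>\<zeta>\<^sup>a\<^sup>+\<^sup>e\<^sup>(\<^sup>i\<^sup>)\<close> with \<open>a\<close> in the representative of \<open>\<tau> i\<close>.  A single point \<open>1\<close> in
  a slot of type \<open>S\<close> produces the same nonzero roots as the points \<open>\<zeta>\<^sup>a\<close>, \<open>a \<in> S\<close>,
  in slots of the singleton type, when the singleton is represented by \<open>{0}\<close> and all other points
  are \<open>0\<close>; there is room for them because the singleton has multiplicity at least \<open>d \<ge> |S|\<close>.  Transferring this coincidence to \<open>\<pi>'\<close> gives
  \<open>E\<^sub>i = \<Sum>\<^sub>a\<^sub>\<in>\<^sub>S \<zeta>\<^sup>a B\<close>, with one multiset \<open>B\<close> for all slots \<open>i\<close>.  Some slot is
  sent to the singleton type of \<open>\<pi>'\<close>, where \<open>E\<^sub>i\<close> has one element, so \<open>B\<close> has one element and every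
  representative for \<open>\<tau> i\<close> is a translate of \<open>S\<close> (\<open>lift_preserves_necklaces\<close>).  Since the
  necklaces within each profile are distinct, \<open>\<tau>\<close> is a bijection of types up to the numbering of slots, and counting
  slots gives equality of multiplicities (\<open>profile_bijection\<close>).
\<close>

section \<open>Points of projective space\<close>

lemma proj_rel_refl: "x \<noteq> (\<lambda>_. 0) \<Longrightarrow> proj_rel x x"
  unfolding proj_rel_def by (auto intro: exI[of _ 1])

lemma pclass_eq_iff:
  assumes "x \<noteq> (\<lambda>_. 0)" "y \<noteq> (\<lambda>_. 0)"
  shows "pclass x = pclass y \<longleftrightarrow> (\<exists>c. c \<noteq> 0 \<and> y = (\<lambda>i. c * x i))"
  using Quotient_rel[OF Quotient_proj, of x y] proj_rel_refl[OF assms(1)] proj_rel_refl[OF assms(2)]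
  by (auto simp: proj_rel_def)

lemma pclass_scale:
  assumes "c \<noteq> 0"
  shows "pclass (\<lambda>i. c * x i) = pclass x"
proof (cases "x = (\<lambda>_. 0)")
  case False
  then have "(\<lambda>i. c * x i) \<noteq> (\<lambda>_. 0)"
    using assms by (auto simp: fun_eq_iff)
  with False assms show ?thesis
    using pclass_eq_iff[of x "\<lambda>i. c * x i"] by auto
qed simp

lemma pcoord_nonzero: "pcoord p \<noteq> (\<lambda>_. 0)"
  using Quotient_rep_reflp[OF Quotient_proj, of p] by (auto simp: proj_rel_def)

lemma pclass_pcoord [simp]: "pclass (pcoord p) = p"
  by (rule Quotient_abs_rep[OF Quotient_proj])

lemma pcoord_pclass:
  assumes "x \<noteq> (\<lambda>_. 0)"
  obtains c where "c \<noteq> 0" "pcoord (pclass x) = (\<lambda>i. c * x i)"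
  using pclass_eq_iff[OF assms pcoord_nonzero, of "pclass x"] by auto

lemma pcoord_beyond:
  assumes "p \<in> proj_space N" "i > N"
  shows "pcoord p i = 0"
proof -
  obtain x where x: "p = pclass x" "x \<noteq> (\<lambda>_. 0)" "\<And>i. i > N \<Longrightarrow> x i = 0"
    using assms(1) unfolding proj_space_def by blast
  obtain c where "pcoord p = (\<lambda>i. c * x i)"
    using pcoord_pclass[OF x(2)] x(1) by blast
  then show ?thesis using x(3)[OF assms(2)] by simp
qed

lemma coeff_nonzero: "P \<noteq> 0 \<Longrightarrow> coeff P \<noteq> (\<lambda>_. 0)"
  by (auto simp: poly_eq_iff)

lemma pclass_coeff_smult:
  assumes "c \<noteq> 0"
  shows "pclass (coeff (smult c P)) = pclass (coeff P)"
proof -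
  have "coeff (smult c P) = (\<lambda>i. c * coeff P i)" by auto
  then show ?thesis using pclass_scale[OF assms, of "coeff P"] by simp
qed

text \<open>
  Proportional forms have the same zeros.  This is how equations between points of projective space
  are turned into equations between multisets of roots.
\<close>

lemma pclass_coeff_eq_imp_proots_eq:
  fixes P Q :: "'a::field poly"
  assumes "P \<noteq> 0" "Q \<noteq> 0" "pclass (coeff P) = pclass (coeff Q)"
  shows "proots P = proots Q"
proof -
  obtain c where c: "c \<noteq> 0" "coeff Q = (\<lambda>i. c * coeff P i)"
    using assms pclass_eq_iff[OF coeff_nonzero[OF assms(1)] coeff_nonzero[OF assms(2)]] by blast
  then have "Q = smult c P" by (auto simp: poly_eq_iff)
  with c(1) show ?thesis by simp
qed

text \<open>
  The identification of the field with the chart \<open>v \<noteq> 0\<close> of \<open>\<bbbP>\<^sup>1\<close>.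
\<close>

definition aff :: "'a::field \<Rightarrow> 'a proj" where
  "aff w = pclass (\<lambda>i. if i = 0 then w else if i = 1 then 1 else 0)"

lemma pcoord_aff:
  obtains c where "c \<noteq> 0" "pcoord (aff w) = (\<lambda>i. c * (if i = 0 then w else if i = 1 then 1 else 0))"
proof -
  have "(\<lambda>i::nat. if i = 0 then w else if i = 1 then 1 else 0) \<noteq> (\<lambda>_. 0)"
    by (auto simp: fun_eq_iff intro!: exI[of _ 1])
  from pcoord_pclass[OF this] that show thesis unfolding aff_def by blast
qed

lemma aff_eq_iff [simp]: "aff u = aff w \<longleftrightarrow> u = w"
proof
  assume *: "aff u = aff w"
  obtain c where c: "c \<noteq> 0" "pcoord (aff u) = (\<lambda>i. c * (if i = 0 then u else if i = 1 then 1 else 0))"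
    by (rule pcoord_aff)
  obtain e where e: "e \<noteq> 0" "pcoord (aff w) = (\<lambda>i. e * (if i = 0 then w else if i = 1 then 1 else 0))"
    by (rule pcoord_aff)
  have "\<And>i. pcoord (aff u) i = pcoord (aff w) i" using * by simp
  from this[of 0] this[of 1] c e show "u = w" by auto
qed simp

lemma aff_in_P1: "aff w \<in> proj_space 1"
  unfolding aff_def proj_space_def
  by (auto simp: fun_eq_iff
      intro!: exI[of _ "\<lambda>i. if i = 0 then w else if i = 1 then 1 else 0"] exI[of _ "1::nat"])

lemma P1_cases:
  assumes "p \<in> proj_space 1" "pcoord p 1 \<noteq> 0"
  shows "p = aff (pcoord p 0 / pcoord p 1)"
proof -
  have "pcoord p = (\<lambda>i. pcoord p 1 * (if i = 0 then pcoord p 0 / pcoord p 1 else if i = 1 then 1 else 0))"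
    using assms(2) pcoord_beyond[OF assms(1)] by (auto simp: fun_eq_iff)
  then have "pclass (pcoord p) = aff (pcoord p 0 / pcoord p 1)"
    unfolding aff_def
    using pclass_scale[OF assms(2), of "\<lambda>i. if i = 0 then pcoord p 0 / pcoord p 1 else if i = 1 then 1 else 0"]
    by simp
  then show ?thesis by simp
qed

lemma power_point_aff [simp]:
  assumes "d > 0"
  shows "power_point d (aff w) = aff (w ^ d)"
proof -
  obtain c where c: "c \<noteq> 0" "pcoord (aff w) = (\<lambda>i. c * (if i = 0 then w else if i = 1 then 1 else 0))"
    by (rule pcoord_aff)
  have "(\<lambda>i. pcoord (aff w) i ^ d) = (\<lambda>i. c ^ d * (if i = 0 then w ^ d else if i = 1 then 1 else 0))"
    using assms by (auto simp: c(2) fun_eq_iff power_mult_distrib)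
  then show ?thesis
    unfolding power_point_def aff_def[of "w ^ d"]
    using pclass_scale[of "c ^ d" "\<lambda>i. if i = 0 then w ^ d else if i = 1 then 1 else 0"] c(1) by simp
qed

text \<open>
  The affine chart is the full preimage of itself under the power map.  Hence a lift that is compatible
  with the relation maps takes affine configurations to affine configurations.
\<close>

lemma power_point_eq_aff:
  assumes "p \<in> proj_space 1" "power_point d p = aff u" "d > 0"
  obtains w where "p = aff w" "w ^ d = u"
proof -
  have nz: "(\<lambda>i. pcoord p i ^ d) \<noteq> (\<lambda>_. 0)"
    using pcoord_nonzero[of p] assms(3) by (auto simp: fun_eq_iff)
  obtain c where c: "c \<noteq> 0" "pcoord (power_point d p) = (\<lambda>i. c * pcoord p i ^ d)"
    unfolding power_point_def by (rule pcoord_pclass[OF nz])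
  obtain e where e: "e \<noteq> 0" "pcoord (aff u) = (\<lambda>i. e * (if i = 0 then u else if i = 1 then 1 else 0))"
    by (rule pcoord_aff)
  have "c * pcoord p 1 ^ d = e"
    using fun_cong[OF c(2), of 1] fun_cong[OF e(2), of 1] assms(2) by simp
  then have "pcoord p 1 \<noteq> 0" using e(1) assms(3) by auto
  then have p: "p = aff (pcoord p 0 / pcoord p 1)" by (rule P1_cases[OF assms(1)])
  then have "aff ((pcoord p 0 / pcoord p 1) ^ d) = aff u"
    using power_point_aff[OF assms(3)] assms(2) by metis
  then have "(pcoord p 0 / pcoord p 1) ^ d = u" by simp
  with p that show thesis by blast
qed

section \<open>Roots of unity and necklaces\<close>

lemma primitive_root_nonzero: "primitive_root d \<zeta> \<Longrightarrow> d > 0 \<Longrightarrow> \<zeta> \<noteq> 0"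
  by (auto simp: primitive_root_def power_0_left)

lemma primitive_root_power_power: "primitive_root d \<zeta> \<Longrightarrow> (\<zeta> ^ k) ^ d = 1"
  by (metis mult.commute power_mult power_one primitive_root_def)

lemma primitive_root_power_mod:
  assumes "primitive_root d \<zeta>"
  shows "\<zeta> ^ (n mod d) = \<zeta> ^ n"
proof -
  have "\<zeta> ^ d = 1" using assms unfolding primitive_root_def by blast
  have "\<zeta> ^ n = \<zeta> ^ (d * (n div d) + n mod d)" by (simp only: mult_div_mod_eq)
  also have "\<dots> = (\<zeta> ^ d) ^ (n div d) * \<zeta> ^ (n mod d)" by (simp only: power_add power_mult)
  also have "\<dots> = \<zeta> ^ (n mod d)" unfolding \<open>\<zeta> ^ d = 1\<close> by simp
  finally show ?thesis by (rule sym)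
qed

lemma primitive_root_inj:
  fixes \<zeta> :: "'a::field"
  assumes "primitive_root d \<zeta>" "d > 0"
  shows "inj_on (\<lambda>k. \<zeta> ^ k) {..<d}"
proof -
  have \<zeta>: "\<zeta> ^ d = 1" "\<And>k. 0 < k \<Longrightarrow> k < d \<Longrightarrow> \<zeta> ^ k \<noteq> 1"
    using assms(1) by (auto simp: primitive_root_def)
  have "\<zeta> \<noteq> 0" by (rule primitive_root_nonzero[OF assms])
  show ?thesis
  proof (rule linorder_inj_onI)
    fix j k assume jk: "j < k" "j \<in> {..<d}" "k \<in> {..<d}"
    have "\<zeta> ^ k = \<zeta> ^ j * \<zeta> ^ (k - j)" using jk by (simp flip: power_add)
    moreover have "\<zeta> ^ (k - j) \<noteq> 1" using \<zeta>(2)[of "k - j"] jk by auto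
    ultimately show "\<zeta> ^ j \<noteq> \<zeta> ^ k" using \<open>\<zeta> \<noteq> 0\<close> by simp
  qed auto
qed

text \<open>
  The \<open>d\<close> distinct powers of \<open>\<zeta>\<close> already exhaust the roots of \<open>X\<^sup>d - 1\<close>.
\<close>

lemma root_of_unity_power:
  fixes \<zeta> :: "'a::field"
  assumes "primitive_root d \<zeta>" "d > 0" "z ^ d = 1"
  shows "\<exists>k<d. z = \<zeta> ^ k"
proof -
  have inj: "inj_on (\<lambda>k. \<zeta> ^ k) {..<d}" by (rule primitive_root_inj[OF assms(1,2)])
  define P where "P = monom (1::'a) d - 1"
  have "coeff P d = 1" using assms(2) by (simp add: P_def)
  then have P: "P \<noteq> 0" by auto
  have "degree P \<le> d" unfolding P_def by (intro degree_diff_le) (auto simp: degree_monom_le)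
  have sub: "(\<lambda>k. \<zeta> ^ k) ` {..<d} \<subseteq> {x. poly P x = 0}"
    using primitive_root_power_power[OF assms(1)] by (auto simp: P_def poly_monom)
  have "card {x. poly P x = 0} \<le> card ((\<lambda>k. \<zeta> ^ k) ` {..<d})"
    using card_poly_roots_bound[OF P] \<open>degree P \<le> d\<close> card_image[OF inj] by simp
  then have "(\<lambda>k. \<zeta> ^ k) ` {..<d} = {x. poly P x = 0}"
    using sub poly_roots_finite[OF P] by (intro card_subset_eq) (auto intro: card_mono antisym)
  moreover have "z \<in> {x. poly P x = 0}" using assms(3) by (simp add: P_def poly_monom)
  ultimately show ?thesis by auto
qed

lemma translate_translate:
  "translate d t (translate d s S) = translate d ((t + s) mod d) S"
  unfolding translate_def image_image
  by (intro image_cong refl) (simp add: mod_add_left_eq mod_add_right_eq add.assoc add.commute[of s t])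

lemma translate_0: "S \<subseteq> {..<d} \<Longrightarrow> translate d 0 S = S"
  by (simp add: translate_def image_cong[where g = "\<lambda>a. a"] subset_iff)

lemma necklace_self: "d > 0 \<Longrightarrow> S \<subseteq> {..<d} \<Longrightarrow> S \<in> necklace d S"
  unfolding necklace_def using translate_0[of S d] by (intro CollectI exI[of _ 0]) simp

lemma necklace_translate:
  assumes "d > 0" "s < d"
  shows "necklace d (translate d s S) = necklace d S"
proof
  show "necklace d (translate d s S) \<subseteq> necklace d S"
    using assms(1) by (auto simp: necklace_def translate_translate)
next
  show "necklace d S \<subseteq> necklace d (translate d s S)"
  proof
    fix A assume "A \<in> necklace d S"
    then obtain t where t: "t < d" "A = translate d t S" by (auto simp: necklace_def)
    have "((t + d - s) mod d + s) mod d = t"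
      using assms t(1) by (simp add: mod_add_left_eq)
    then have "A = translate d ((t + d - s) mod d) (translate d s S)"
      by (simp add: translate_translate t(2))
    moreover have "(t + d - s) mod d < d" using assms(1) by simp
    ultimately show "A \<in> necklace d (translate d s S)" unfolding necklace_def by blast
  qed
qed

lemma necklace_singleton:
  assumes "d > 0" "S \<subseteq> {..<d}" "necklace d S = necklace d {0}"
  obtains c where "S = {c}"
proof -
  have "S \<in> necklace d {0}" using necklace_self[OF assms(1,2)] by (simp only: assms(3))
  then obtain t where "S = translate d t {0}" unfolding necklace_def by blast
  then have "S = {(0 + t) mod d}" by (simp only: translate_def image_insert image_empty)
  then show thesis by (rule that)
qed

text \<open>
  Exponents of \<open>\<zeta>\<close> are determined modulo \<open>d\<close>, so multiplying a set of powers of \<open>\<zeta>\<close> by a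
  root of unity amounts to translating the set of exponents.
\<close>

lemma translate_from_powers:
  fixes \<zeta> :: "'a::field"
  assumes \<zeta>: "primitive_root d \<zeta>" "d > 0" and S: "S' \<subseteq> {..<d}"
    and z: "z ^ d = 1" and eq: "(\<lambda>a. \<zeta> ^ a) ` S' = (\<lambda>a. z * \<zeta> ^ a) ` S"
  obtains s where "s < d" "S' = translate d s S"
proof -
  obtain s where s: "s < d" "z = \<zeta> ^ s" using root_of_unity_power[OF \<zeta> z] by blast
  note mod = primitive_root_power_mod[OF \<zeta>(1)]
  have "(\<lambda>a. \<zeta> ^ a) ` S' = (\<lambda>a. \<zeta> ^ a) ` translate d s S"
    unfolding eq translate_def image_image mod by (simp add: s(2) power_add mult.commute)
  moreover have "translate d s S \<subseteq> {..<d}" using \<zeta>(2) by (auto simp: translate_def)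
  ultimately have "S' = translate d s S"
    using inj_on_image_eq_iff[OF primitive_root_inj[OF \<zeta>] S] by blast
  with s(1) that show thesis by blast
qed

section \<open>Products of linear factors\<close>

lemma prod_mset_smult_ex:
  fixes f g :: "'i \<Rightarrow> 'a::field poly"
  assumes "\<And>i. i \<in># M \<Longrightarrow> \<exists>c. c \<noteq> 0 \<and> f i = smult c (g i)"
  shows "\<exists>c. c \<noteq> 0 \<and> (\<Prod>i\<in>#M. f i) = smult c (\<Prod>i\<in>#M. g i)"
  using assms
proof (induction M)
  case (add x M)
  then obtain c where "c \<noteq> 0" "(\<Prod>i\<in>#M. f i) = smult c (\<Prod>i\<in>#M. g i)" by auto
  moreover from add obtain e where "e \<noteq> 0" "f x = smult e (g x)" by auto
  ultimately show ?case by (auto simp: mult.commute intro!: exI[of _ "e * c"])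
qed (auto intro: exI[of _ 1])

lemma prod_smult_ex:
  fixes f g :: "'i \<Rightarrow> 'a::field poly"
  assumes "finite A" "\<And>i. i \<in> A \<Longrightarrow> \<exists>c. c \<noteq> 0 \<and> f i = smult c (g i)"
  shows "\<exists>c. c \<noteq> 0 \<and> prod f A = smult c (prod g A)"
  unfolding prod_unfold_prod_mset using assms by (intro prod_mset_smult_ex) auto

lemma sum_single_mset: "finite A \<Longrightarrow> (\<Sum>i\<in>A. {#w i#}) = image_mset w (mset_set A)"
  by (induction A rule: finite_induct) auto

lemma proots_prod_linear:
  fixes w :: "'i \<Rightarrow> 'a::field"
  assumes "finite A"
  shows "proots (\<Prod>i\<in>A. [: - w i, 1 :]) = image_mset w (mset_set A)"
  using assms by (subst proots_prod) (auto simp: sum_single_mset)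

section \<open>Labelled configurations\<close>

text \<open>
  A labelled description of points of a product of symmetric powers: label \<open>i\<close> contributes the
  affine point \<open>w i\<close> to the factor \<open>\<tau> i\<close>.  The same label set \<open>I\<close> serves a configuration for
  \<open>\<pi>\<close> and its image for \<open>\<pi>'\<close>, with different maps \<open>\<tau>\<close>.
\<close>

definition config :: "'j set \<Rightarrow> 'l set \<Rightarrow> ('l \<Rightarrow> 'j) \<Rightarrow> ('l \<Rightarrow> 'a::field) \<Rightarrow> 'j \<Rightarrow> 'a proj multiset" where
  "config T I \<tau> w = (\<lambda>\<nu>\<in>T. image_mset (\<lambda>i. aff (w i)) (mset_set {i\<in>I. \<tau> i = \<nu>}))"

lemma prod_mset_config:
  "finite I \<Longrightarrow> \<nu> \<in> T \<Longrightarrow> (\<Prod>p\<in>#config T I \<tau> w \<nu>. h p) = (\<Prod>i | i \<in> I \<and> \<tau> i = \<nu>. h (aff (w i)))"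
  by (simp add: config_def prod_unfold_prod_mset image_mset.compositionality o_def)

lemma orbit_form_aff: "finite S \<Longrightarrow> \<exists>c. c \<noteq> 0 \<and> orbit_form \<zeta> S (aff w) = smult c (\<Prod>a\<in>S. [: - (\<zeta> ^ a * w), 1 :])"
  unfolding orbit_form_def
proof (rule prod_smult_ex)
  fix a
  obtain c where c: "c \<noteq> 0" "pcoord (aff w) = (\<lambda>i. c * (if i = 0 then w else if i = 1 then 1 else 0))"
    by (rule pcoord_aff)
  then show "\<exists>c. c \<noteq> 0 \<and> [: - (\<zeta> ^ a * pcoord (aff w) 0), pcoord (aff w) 1 :] = smult c [: - (\<zeta> ^ a * w), 1 :]"
    by (intro exI[of _ c]) auto
qed

lemma Sym_coord_config:
  assumes "finite I" "\<nu> \<in> T"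
  shows "Sym_coord (config T I \<tau> w \<nu>) = pclass (coeff (\<Prod>i | i \<in> I \<and> \<tau> i = \<nu>. [: - w i, 1 :]))"
proof -
  have "\<exists>c. c \<noteq> 0 \<and> (\<Prod>i | i \<in> I \<and> \<tau> i = \<nu>. [: - pcoord (aff (w i)) 0, pcoord (aff (w i)) 1 :])
     = smult c (\<Prod>i | i \<in> I \<and> \<tau> i = \<nu>. [: - w i, 1 :])"
  proof (rule prod_smult_ex)
    fix i
    obtain c where c: "c \<noteq> 0" "pcoord (aff (w i)) = (\<lambda>j. c * (if j = 0 then w i else if j = 1 then 1 else 0))"
      by (rule pcoord_aff)
    then show "\<exists>c. c \<noteq> 0 \<and> [: - pcoord (aff (w i)) 0, pcoord (aff (w i)) 1 :] = smult c [: - w i, 1 :]"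
      by (intro exI[of _ c]) auto
  qed (use assms in auto)
  then show ?thesis
    using assms by (auto simp: Sym_coord_def prod_mset_config pclass_coeff_smult)
qed

lemma f_map_config:
  assumes "finite I" "finite (types \<pi>)" "\<tau> ` I \<subseteq> types \<pi>" "\<And>\<nu>. \<nu> \<in> types \<pi> \<Longrightarrow> finite (rep \<pi> \<nu>)"
  shows "f_map \<zeta> \<pi> (config (types \<pi>) I \<tau> w) =
    pclass (coeff (\<Prod>i\<in>I. \<Prod>a\<in>rep \<pi> (\<tau> i). [: - (\<zeta> ^ a * w i), 1 :]))"
proof -
  have "(\<Prod>\<nu>\<in>types \<pi>. \<Prod>p\<in>#config (types \<pi>) I \<tau> w \<nu>. orbit_form \<zeta> (rep \<pi> \<nu>) p)
    = (\<Prod>\<nu>\<in>types \<pi>. \<Prod>i | i \<in> I \<and> \<tau> i = \<nu>. orbit_form \<zeta> (rep \<pi> \<nu>) (aff (w i)))"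
    using assms(1) by (intro prod.cong refl prod_mset_config)
  also have "\<dots> = (\<Prod>\<nu>\<in>types \<pi>. \<Prod>i | i \<in> I \<and> \<tau> i = \<nu>. orbit_form \<zeta> (rep \<pi> (\<tau> i)) (aff (w i)))"
    by (intro prod.cong refl) auto
  also have "\<dots> = (\<Prod>i\<in>I. orbit_form \<zeta> (rep \<pi> (\<tau> i)) (aff (w i)))"
    using assms by (intro prod.group) auto
  finally have eq: "(\<Prod>\<nu>\<in>types \<pi>. \<Prod>p\<in>#config (types \<pi>) I \<tau> w \<nu>. orbit_form \<zeta> (rep \<pi> \<nu>) p) = \<dots>" .
  have "\<exists>c. c \<noteq> 0 \<and> (\<Prod>i\<in>I. orbit_form \<zeta> (rep \<pi> (\<tau> i)) (aff (w i)))
    = smult c (\<Prod>i\<in>I. \<Prod>a\<in>rep \<pi> (\<tau> i). [: - (\<zeta> ^ a * w i), 1 :])"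
    using assms by (intro prod_smult_ex orbit_form_aff) auto
  then show ?thesis
    unfolding f_map_def eq by (auto simp: pclass_coeff_smult)
qed

lemma sum_mset_fibres:
  assumes "finite I" "finite T" "\<tau> ` I \<subseteq> T"
  shows "(\<Sum>\<nu>\<in>T. image_mset h (mset_set {i\<in>I. \<tau> i = \<nu>})) = image_mset h (mset_set I)"
proof -
  have "mset_set I = (\<Sum>\<nu>\<in>T. mset_set {i\<in>I. \<tau> i = \<nu>})"
  proof (rule multiset_eqI)
    fix i
    have "(\<Sum>\<nu>\<in>T. count (mset_set {i\<in>I. \<tau> i = \<nu>}) i) = (\<Sum>\<nu>\<in>T. if \<nu> = \<tau> i then if i \<in> I then 1 else 0 else 0)"
      using assms(1) by (intro sum.cong) (auto simp: count_mset_set')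
    also have "\<dots> = count (mset_set I) i"
      using assms by (auto simp: count_mset_set')
    finally show "count (mset_set I) i = count (\<Sum>\<nu>\<in>T. mset_set {i\<in>I. \<tau> i = \<nu>}) i"
      by (simp add: count_sum)
  qed
  then show ?thesis
    using sum_comp_morphism[of "image_mset h" "\<lambda>\<nu>. mset_set {i\<in>I. \<tau> i = \<nu>}" T] by (simp add: o_def)
qed

lemma q_hat_config:
  assumes "finite I" "finite (types \<pi>)" "\<tau> ` I \<subseteq> types \<pi>" "d > 0"
  shows "q_hat d \<pi> (config (types \<pi>) I \<tau> w) = image_mset (\<lambda>i. aff (w i ^ d)) (mset_set I)"
proof -
  have "q_hat d \<pi> (config (types \<pi>) I \<tau> w) =
    (\<Sum>\<nu>\<in>types \<pi>. image_mset (\<lambda>i. aff (w i ^ d)) (mset_set {i\<in>I. \<tau> i = \<nu>}))"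
    unfolding q_hat_def config_def using assms(4)
    by (intro sum.cong) (auto simp: image_mset.compositionality o_def)
  then show ?thesis using sum_mset_fibres[OF assms(1-3)] by metis
qed

text \<open>
  Each factor of the target has a prescribed number of points, which counts the labels sent to it.
\<close>

lemma config_in_N_card:
  assumes "config (types \<pi>') I \<tau> w \<in> pts (N_var \<pi>')" "\<nu> \<in> types \<pi>'"
  shows "card {i\<in>I. \<tau> i = \<nu>} = mult \<pi>' \<nu>"
proof -
  have "size (config (types \<pi>') I \<tau> w \<nu>) = mult \<pi>' \<nu>"
    using assms by (auto simp: N_var_def Sym_P1_def PiE_iff)
  then show ?thesis using assms(2) by (simp add: config_def)
qed

text \<open>
  The zeros of the form that represents the image of a configuration, where \<open>R i\<close> is the
  set of exponents attached to label \<open>i\<close>.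
\<close>

definition roots :: "'a::field \<Rightarrow> 'l set \<Rightarrow> ('l \<Rightarrow> nat set) \<Rightarrow> ('l \<Rightarrow> 'a) \<Rightarrow> 'a multiset" where
  "roots \<zeta> I R w = (\<Sum>i\<in>I. image_mset (\<lambda>a. \<zeta> ^ a * w i) (mset_set (R i)))"

text \<open>
  The binary forms in question are monic after scaling and split into linear factors, so they are
  determined by their roots.
\<close>

lemma f_map_config_eq_iff:
  fixes \<zeta> :: "'a::field"
  assumes "finite I" "finite (types \<pi>)" "\<tau> ` I \<subseteq> types \<pi>" "\<And>\<nu>. \<nu> \<in> types \<pi> \<Longrightarrow> finite (rep \<pi> \<nu>)"
  shows "f_map \<zeta> \<pi> (config (types \<pi>) I \<tau> u) = f_map \<zeta> \<pi> (config (types \<pi>) I \<tau> v) \<longleftrightarrow>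
    roots \<zeta> I (\<lambda>i. rep \<pi> (\<tau> i)) u = roots \<zeta> I (\<lambda>i. rep \<pi> (\<tau> i)) v"
proof -
  let ?P = "\<lambda>w. \<Prod>i\<in>I. \<Prod>a\<in>rep \<pi> (\<tau> i). [: - (\<zeta> ^ a * w i), 1 :]"
  let ?r = "\<lambda>w. roots \<zeta> I (\<lambda>i. rep \<pi> (\<tau> i)) w"
  have fin: "finite (rep \<pi> (\<tau> i))" if "i \<in> I" for i using assms(3,4) that by auto
  have nz: "?P w \<noteq> 0" for w
    using fin assms(1) by simp
  have "proots (?P w) = (\<Sum>i\<in>I. proots (\<Prod>a\<in>rep \<pi> (\<tau> i). [: - (\<zeta> ^ a * w i), 1 :]))" for w
    using fin by (intro proots_prod) auto
  then have proots: "proots (?P w) = ?r w" for w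
    using fin by (simp add: roots_def proots_prod_linear)
  have prod: "?P w = (\<Prod>r\<in>#?r w. [: - r, 1 :])" for w
  proof -
    have "(\<Prod>r\<in>#(\<Sum>i\<in>J. image_mset (\<lambda>a. \<zeta> ^ a * w i) (mset_set (rep \<pi> (\<tau> i)))). [: - r, 1 :]) =
      (\<Prod>i\<in>J. \<Prod>a\<in>rep \<pi> (\<tau> i). [: - (\<zeta> ^ a * w i), 1 :])" if "finite J" for J
      using that by (induction J rule: finite_induct)
        (auto simp: prod_unfold_prod_mset image_mset.compositionality o_def)
    from this[OF assms(1)] show ?thesis by (simp add: roots_def)
  qed
  have "pclass (coeff (?P u)) = pclass (coeff (?P v)) \<longleftrightarrow> ?r u = ?r v"
  proof
    assume "pclass (coeff (?P u)) = pclass (coeff (?P v))"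
    from pclass_coeff_eq_imp_proots_eq[OF nz nz this] show "?r u = ?r v" by (simp only: proots)
  next
    assume "?r u = ?r v"
    then show "pclass (coeff (?P u)) = pclass (coeff (?P v))" by (simp only: prod)
  qed
  then show ?thesis by (simp only: f_map_config[OF assms])
qed

lemma size_roots: "size (roots \<zeta> I R w) = (\<Sum>i\<in>I. card (R i))"
  by (simp add: roots_def)

text \<open>
  Placing some of the points at \<open>0\<close> restricts attention to the remaining labels without changing
  the number of points of each type.
\<close>

lemma nonzero_roots:
  fixes \<zeta> :: "'a::field"
  assumes "\<zeta> \<noteq> 0" "finite I" "J \<subseteq> I" "\<And>i. i \<in> I \<Longrightarrow> w i \<noteq> 0 \<longleftrightarrow> i \<in> J"
  shows "filter_mset (\<lambda>z. z \<noteq> 0) (roots \<zeta> I R w) = roots \<zeta> J R w"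
proof -
  have "filter_mset (\<lambda>z. z \<noteq> 0) (roots \<zeta> I R w) =
      (\<Sum>i\<in>I. filter_mset (\<lambda>z. z \<noteq> 0) (image_mset (\<lambda>a. \<zeta> ^ a * w i) (mset_set (R i))))"
    using sum_comp_morphism[of "filter_mset (\<lambda>z. z \<noteq> 0)" "\<lambda>i. image_mset (\<lambda>a. \<zeta> ^ a * w i) (mset_set (R i))" I]
    by (simp add: roots_def o_def)
  also have "\<dots> = (\<Sum>i\<in>I. if i \<in> J then image_mset (\<lambda>a. \<zeta> ^ a * w i) (mset_set (R i)) else {#})"
    using assms(1,4) by (intro sum.cong refl) (auto simp: filter_mset_image_mset)
  also have "\<dots> = (\<Sum>i\<in>I \<inter> J. image_mset (\<lambda>a. \<zeta> ^ a * w i) (mset_set (R i)))"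
    using assms(2) by (simp add: sum.inter_restrict)
  finally show ?thesis using assms(3) by (simp add: roots_def Int_absorb1)
qed

lemma mset_eq_if_nonzero_parts_eq:
  assumes "filter_mset (\<lambda>z. z \<noteq> 0) M = filter_mset (\<lambda>z. z \<noteq> 0) N" "size M = size N"
  shows "M = (N :: 'a::zero multiset)"
proof -
  have *: "K = filter_mset (\<lambda>z. z \<noteq> 0) K + replicate_mset (count K 0) 0" for K :: "'a multiset"
    by (rule multiset_eqI) auto
  have "count M 0 = count N 0"
    using arg_cong[OF *[of M], of size] arg_cong[OF *[of N], of size] assms by simp
  with * assms(1) show ?thesis by metis
qed

text \<open>
  The label \<open>(\<nu>, k)\<close> stands for the \<open>k\<close>-th of the unordered points of the factor \<open>\<nu>\<close>.
\<close>

definition slots :: "'i profile \<Rightarrow> ('i \<times> nat) set" where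
  "slots \<pi> = Sigma (types \<pi>) (\<lambda>\<nu>. {..<mult \<pi> \<nu>})"

abbreviation conf :: "'i profile \<Rightarrow> ('i \<times> nat \<Rightarrow> 'a::field) \<Rightarrow> 'i \<Rightarrow> 'a proj multiset" where
  "conf \<pi> u \<equiv> config (types \<pi>) (slots \<pi>) fst u"

lemma finite_slots: "finite (types \<pi>) \<Longrightarrow> finite (slots \<pi>)"
  by (simp add: slots_def)

lemma fst_slots: "fst ` slots \<pi> \<subseteq> types \<pi>"
  by (auto simp: slots_def)

lemma slots_fibre: "\<nu> \<in> types \<pi> \<Longrightarrow> {i\<in>slots \<pi>. fst i = \<nu>} = Pair \<nu> ` {..<mult \<pi> \<nu>}"
  by (auto simp: slots_def)

lemma conf_in_N: "conf \<pi> u \<in> pts (N_var \<pi>)"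
proof -
  have "size (conf \<pi> u \<nu>) = mult \<pi> \<nu>" if "\<nu> \<in> types \<pi>" for \<nu>
    using that by (simp add: config_def slots_fibre card_image inj_on_def)
  moreover have "set_mset (conf \<pi> u \<nu>) \<subseteq> proj_space 1" if "\<nu> \<in> types \<pi>" for \<nu>
    using that by (auto simp: config_def aff_in_P1 simp del: One_nat_def)
  moreover have "conf \<pi> u \<in> extensional (types \<pi>)" by (simp add: config_def)
  ultimately show ?thesis
    by (auto simp: N_var_def Sym_P1_def PiE_iff simp del: One_nat_def)
qed

section \<open>Distributions of labels at a single point\<close>

text \<open>
  Equality of multisets of values can be realized by a labelling, which is built greedily: the value \<open>g i\<close>
  occurs on the left, so some point lying over it can be assigned the label \<open>i\<close> and removed.
\<close>

lemma distribute_labels: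
  assumes "finite T" "finite I"
    and "(\<Sum>\<nu>\<in>T. image_mset f (A \<nu>)) = image_mset g (mset_set I)"
  shows "\<exists>\<tau> w. \<tau> ` I \<subseteq> T \<and> (\<forall>i\<in>I. f (w i) = g i) \<and>
    (\<forall>\<nu>\<in>T. A \<nu> = image_mset w (mset_set {i\<in>I. \<tau> i = \<nu>}))"
  using assms(2,3)
proof (induction I arbitrary: A rule: finite_induct)
  case empty
  then have "set_mset (\<Sum>\<nu>\<in>T. image_mset f (A \<nu>)) = {}" by simp
  then have "\<forall>\<nu>\<in>T. A \<nu> = {#}" using assms(1) by (simp add: set_mset_sum)
  then show ?case by simp
next
  case (insert i I)
  have "g i \<in># (\<Sum>\<nu>\<in>T. image_mset f (A \<nu>))"
    using insert by simp
  then obtain \<nu>0 p where p: "\<nu>0 \<in> T" "p \<in># A \<nu>0" "g i = f p"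
    using assms(1) by (auto simp: set_mset_sum)
  define B where "B = A(\<nu>0 := A \<nu>0 - {#p#})"
  have A: "A \<nu>0 = add_mset p (B \<nu>0)" "\<And>\<nu>. \<nu> \<noteq> \<nu>0 \<Longrightarrow> A \<nu> = B \<nu>" 
    using p(2) by (auto simp: B_def)
  have "(\<Sum>\<nu>\<in>T. image_mset f (A \<nu>)) = image_mset f (A \<nu>0) + (\<Sum>\<nu>\<in>T-{\<nu>0}. image_mset f (A \<nu>))"
    using assms(1) p(1) by (rule sum.remove)
  also have "\<dots> = add_mset (f p) (image_mset f (B \<nu>0) + (\<Sum>\<nu>\<in>T-{\<nu>0}. image_mset f (B \<nu>)))"
    using A by simp
  also have "\<dots> = add_mset (f p) (\<Sum>\<nu>\<in>T. image_mset f (B \<nu>))"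
    using sum.remove[OF assms(1) p(1), of "\<lambda>\<nu>. image_mset f (B \<nu>)"] by simp
  finally have "(\<Sum>\<nu>\<in>T. image_mset f (B \<nu>)) = image_mset g (mset_set I)"
    using insert p(3) by simp
  from insert.IH[OF this] obtain \<tau> w where *: "\<tau> ` I \<subseteq> T" "\<forall>i\<in>I. f (w i) = g i"
    "\<forall>\<nu>\<in>T. B \<nu> = image_mset w (mset_set {i\<in>I. \<tau> i = \<nu>})" by blast
  define \<tau>' where "\<tau>' = \<tau>(i := \<nu>0)"
  define w' where "w' = w(i := p)"
  have "A \<nu> = image_mset w' (mset_set {j\<in>insert i I. \<tau>' j = \<nu>})" if "\<nu> \<in> T" for \<nu>
  proof -
    have *: "B \<nu> = image_mset w' (mset_set {j\<in>I. \<tau>' j = \<nu>})"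
    proof -
      have "{j\<in>I. \<tau>' j = \<nu>} = {j\<in>I. \<tau> j = \<nu>}" using insert.hyps by (auto simp: \<tau>'_def)
      moreover have "image_mset w' (mset_set {j\<in>I. \<tau> j = \<nu>}) = image_mset w (mset_set {j\<in>I. \<tau> j = \<nu>})"
        using insert.hyps by (intro image_mset_cong) (auto simp: w'_def)
      ultimately show ?thesis using *(3) that by simp
    qed
    show ?thesis
    proof (cases "\<nu> = \<nu>0")
      case True
      then have "{j\<in>insert i I. \<tau>' j = \<nu>} = insert i {j\<in>I. \<tau>' j = \<nu>}" by (auto simp: \<tau>'_def)
      then show ?thesis using * A True insert.hyps by (simp add: w'_def)
    next
      case False
      then have "{j\<in>insert i I. \<tau>' j = \<nu>} = {j\<in>I. \<tau>' j = \<nu>}" by (auto simp: \<tau>'_def)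
      then show ?thesis using * A False by simp
    qed
  qed
  moreover have "\<tau>' ` insert i I \<subseteq> T" using *(1) p(1) by (auto simp: \<tau>'_def)
  moreover have "\<forall>j\<in>insert i I. f (w' j) = g j" using *(2) p(3) by (auto simp: w'_def)
  ultimately show ?case by blast
qed

text \<open>
  At a single configuration: equal \<open>d\<close>-th powers mean equality up to a root of unity, so a point
  with the same relations as \<open>conf \<pi> u\<close> consists of rotated copies of the \<open>u\<^sub>i\<close>, distributed in some way
  among the types of \<open>\<pi>'\<close>.
\<close>

lemma assignment_at_point:
  fixes \<zeta> :: "'a::field"
  assumes "primitive_root d \<zeta>" "d > 0" "finite (types \<pi>)" "finite (types \<pi>')"
    and "x' \<in> pts (N_var \<pi>')" "q_hat d \<pi>' x' = q_hat d \<pi> (conf \<pi> u)"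
  shows "\<exists>\<tau>\<in>slots \<pi> \<rightarrow>\<^sub>E types \<pi>'. \<exists>e\<in>slots \<pi> \<rightarrow>\<^sub>E {..<d}.
    x' = config (types \<pi>') (slots \<pi>) \<tau> (\<lambda>i. \<zeta> ^ e i * u i)"
proof -
  let ?I = "slots \<pi>"
  note fin = finite_slots[OF assms(3)]
  have "(\<Sum>\<nu>\<in>types \<pi>'. image_mset (power_point d) (x' \<nu>)) = image_mset (\<lambda>i. aff (u i ^ d)) (mset_set ?I)"
    using assms(6) q_hat_config[OF fin assms(3) fst_slots assms(2)] by (simp add: q_hat_def)
  from distribute_labels[OF assms(4) fin this] obtain \<tau> p where
    p: "\<tau> ` ?I \<subseteq> types \<pi>'" "\<And>i. i \<in> ?I \<Longrightarrow> power_point d (p i) = aff (u i ^ d)"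
    "\<And>\<nu>. \<nu> \<in> types \<pi>' \<Longrightarrow> x' \<nu> = image_mset p (mset_set {i\<in>?I. \<tau> i = \<nu>})" by blast
  have "\<exists>k<d. p i = aff (\<zeta> ^ k * u i)" if i: "i \<in> ?I" for i
  proof -
    have "p i \<in># x' (\<tau> i)" using p(1) p(3)[of "\<tau> i"] i fin by auto
    moreover have "\<tau> i \<in> types \<pi>'" using p(1) i by auto
    ultimately have "p i \<in> proj_space 1"
      using assms(5) by (auto simp: N_var_def Sym_P1_def PiE_iff simp del: One_nat_def)
    from power_point_eq_aff[OF this p(2)[OF i] assms(2)] obtain w where
      w: "p i = aff w" "w ^ d = u i ^ d" by blast
    show ?thesis
    proof (cases "u i = 0")
      case True
      then have "w = 0" using w(2) assms(2) by (simp add: power_0_left)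
      then show ?thesis using w(1) True assms(2) by auto
    next
      case False
      then have "(w / u i) ^ d = 1" using w(2) by (simp add: power_divide)
      then obtain k where "k < d" "w / u i = \<zeta> ^ k"
        using root_of_unity_power[OF assms(1,2)] by blast
      then show ?thesis using w(1) False by (auto simp: field_simps)
    qed
  qed
  then obtain e where e: "\<And>i. i \<in> ?I \<Longrightarrow> e i < d" "\<And>i. i \<in> ?I \<Longrightarrow> p i = aff (\<zeta> ^ e i * u i)"
    by metis
  define \<tau>' where "\<tau>' = restrict \<tau> ?I"
  define e' where "e' = restrict e ?I"
  have "x' \<nu> = image_mset (\<lambda>i. aff (\<zeta> ^ e' i * u i)) (mset_set {i\<in>?I. \<tau>' i = \<nu>})"
    if "\<nu> \<in> types \<pi>'" for \<nu>
  proof -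
    have "{i\<in>?I. \<tau>' i = \<nu>} = {i\<in>?I. \<tau> i = \<nu>}" by (auto simp: \<tau>'_def)
    then show ?thesis
      using p(3)[OF that] fin by (auto simp: e'_def e intro!: image_mset_cong)
  qed
  moreover have "x' \<in> extensional (types \<pi>')" using assms(5) by (auto simp: N_var_def PiE_iff)
  ultimately have "x' = config (types \<pi>') ?I \<tau>' (\<lambda>i. \<zeta> ^ e' i * u i)"
    by (auto simp: config_def extensional_def)
  moreover have "\<tau>' \<in> ?I \<rightarrow>\<^sub>E types \<pi>'" using p(1) by (auto simp: \<tau>'_def)
  moreover have "e' \<in> ?I \<rightarrow>\<^sub>E {..<d}" using e(1) by (auto simp: e'_def)
  ultimately show ?thesis by blast
qed

text \<open>
  When the coordinates have distinct nonzero \<open>d\<close>-th powers, the \<open>d\<close>-th power of a point reveals its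
  label and then the point itself reveals the rotation.
\<close>

lemma assignment_unique:
  fixes \<zeta> :: "'a::field"
  assumes "primitive_root d \<zeta>" "d > 0" "finite I"
    and "\<tau> \<in> I \<rightarrow>\<^sub>E T" "\<tau>' \<in> I \<rightarrow>\<^sub>E T" "e \<in> I \<rightarrow>\<^sub>E {..<d}" "e' \<in> I \<rightarrow>\<^sub>E {..<d}"
    and b: "inj_on (\<lambda>i. b i ^ d) I" "\<And>i. i \<in> I \<Longrightarrow> b i \<noteq> 0"
    and eq: "config T I \<tau> (\<lambda>i. \<zeta> ^ e i * b i) = config T I \<tau>' (\<lambda>i. \<zeta> ^ e' i * b i)"
  shows "\<tau> = \<tau>'" "e = e'"
proof -
  have "\<tau> i = \<tau>' i \<and> e i = e' i" if i: "i \<in> I" for i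
  proof -
    have "aff (\<zeta> ^ e i * b i) \<in># config T I \<tau> (\<lambda>i. \<zeta> ^ e i * b i) (\<tau> i)"
      using assms(3,4) i by (auto simp: config_def PiE_iff)
    then have "aff (\<zeta> ^ e i * b i) \<in># config T I \<tau>' (\<lambda>i. \<zeta> ^ e' i * b i) (\<tau> i)" by (simp add: eq)
    then obtain j where j: "j \<in> I" "\<tau>' j = \<tau> i" "\<zeta> ^ e i * b i = \<zeta> ^ e' j * b j"
      using assms(3,4) i by (auto simp: config_def PiE_iff)
    have "(\<zeta> ^ k) ^ d = 1" for k
      by (rule primitive_root_power_power[OF assms(1)])
    then have "b i ^ d = b j ^ d"
      using arg_cong[OF j(3), of "\<lambda>z. z ^ d"] by (simp add: power_mult_distrib)
    then have "i = j" using b(1) i j(1) by (auto dest: inj_onD)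
    moreover have "e i = e' i"
      if "\<zeta> ^ e i = \<zeta> ^ e' i"
    proof -
      have "e i < d" "e' i < d" using assms(6,7) i by (auto simp: PiE_iff)
      with that show ?thesis using primitive_root_inj[OF assms(1,2)] by (auto dest: inj_onD)
    qed
    ultimately show ?thesis using j(2,3) b(2)[OF i] by auto
  qed
  then show "\<tau> = \<tau>'" "e = e'"
    using PiE_ext[OF assms(4,5)] PiE_ext[OF assms(6,7)] by blast+
qed

section \<open>Rigidity of the lift\<close>

text \<open>
  Values of multihomogeneous forms on different homogeneous coordinates of one point differ by a common
  factor, which depends on the multidegree but not on the form.
\<close>

lemma peval_multihomogeneous_scale:
  fixes F :: "(('k \<times> nat) \<Rightarrow>\<^sub>0 nat) \<Rightarrow>\<^sub>0 'a::field"
  assumes "finite K" "multihomogeneous K D F"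
  shows "peval F (\<lambda>(k, j). l k * x k j) = (\<Prod>k\<in>K. l k ^ D k) * peval F (\<lambda>(k, j). x k j)"
proof -
  have "(\<Prod>v\<in>Poly_Mapping.keys t. (case v of (k, j) \<Rightarrow> l k * x k j) ^ Poly_Mapping.lookup t v) =
      (\<Prod>k\<in>K. l k ^ D k) * (\<Prod>v\<in>Poly_Mapping.keys t. (case v of (k, j) \<Rightarrow> x k j) ^ Poly_Mapping.lookup t v)"
    if t: "t \<in> Poly_Mapping.keys F" for t
  proof -
    have K: "fst ` Poly_Mapping.keys t \<subseteq> K"
      and D: "\<And>k. k \<in> K \<Longrightarrow> (\<Sum>v | v \<in> Poly_Mapping.keys t \<and> fst v = k. Poly_Mapping.lookup t v) = D k"
      using assms(2) t by (auto simp: multihomogeneous_def)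
    have "(\<Prod>v\<in>Poly_Mapping.keys t. l (fst v) ^ Poly_Mapping.lookup t v) =
      (\<Prod>k\<in>K. \<Prod>v | v \<in> Poly_Mapping.keys t \<and> fst v = k. l (fst v) ^ Poly_Mapping.lookup t v)"
      using prod.group[OF _ assms(1) K, of "\<lambda>v. l (fst v) ^ Poly_Mapping.lookup t v"] by simp
    also have "\<dots> = (\<Prod>k\<in>K. \<Prod>v | v \<in> Poly_Mapping.keys t \<and> fst v = k. l k ^ Poly_Mapping.lookup t v)"
      by (intro prod.cong refl) auto
    also have "\<dots> = (\<Prod>k\<in>K. l k ^ D k)"
      by (intro prod.cong refl) (simp add: D flip: power_sum)
    finally show ?thesis
      by (simp add: case_prod_beta power_mult_distrib prod.distrib)
  qed
  then show ?thesis
    unfolding peval_def sum_distrib_left by (intro sum.cong refl) (simp add: algebra_simps)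
qed

text \<open>
  For \<open>peval\<close>, coefficients and arguments lie in one ring; here the coefficients are constants and the
  arguments are polynomials in a parameter.
\<close>

definition peval_curve :: "(('v \<Rightarrow>\<^sub>0 nat) \<Rightarrow>\<^sub>0 'a::field) \<Rightarrow> ('v \<Rightarrow> 'a poly) \<Rightarrow> 'a poly" where
  "peval_curve F C = (\<Sum>s\<in>Poly_Mapping.keys F. smult (Poly_Mapping.lookup F s)
     (\<Prod>v\<in>Poly_Mapping.keys s. C v ^ Poly_Mapping.lookup s v))"

lemma poly_peval_curve: "poly (peval_curve F C) t = peval F (\<lambda>v. poly (C v) t)"
  by (simp add: peval_curve_def peval_def poly_sum poly_prod)

lemma poly_coeff_prod_linear:
  fixes g :: "'i \<Rightarrow> 'a::field poly"
  assumes "finite A"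
  shows "poly (coeff (\<Prod>i\<in>A. [: - g i, 1 :]) j) t = coeff (\<Prod>i\<in>A. [: - poly (g i) t, 1 :]) j"
  using assms
proof (induction A arbitrary: j rule: finite_induct)
  case empty
  then show ?case by (cases j) auto
next
  case (insert i A)
  then show ?case by (cases j) auto
qed

text \<open>
  If the affine points move polynomially in \<open>t\<close>, then so do the coefficients of the forms with these
  zeros, and therefore also the values of multihomogeneous forms in these coefficients, up to the scalar
  \<open>\<kappa>\<close> that comes from the choice of homogeneous coordinates at each \<open>t\<close>.
\<close>

lemma form_values_along_curve:
  fixes F :: "nat \<Rightarrow> (('i \<times> nat) \<Rightarrow>\<^sub>0 nat) \<Rightarrow>\<^sub>0 'a::field"
  assumes "finite (types \<pi>)" "\<And>i. multihomogeneous (types \<pi>) D (F i)"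
  shows "\<exists>P. \<forall>t. \<exists>\<kappa>. \<kappa> \<noteq> 0 \<and>
    form_values (N_var \<pi>) F (conf \<pi> (\<lambda>i. poly (g i) t)) = (\<lambda>i. \<kappa> * poly (P i) t)"
proof -
  let ?A = "\<lambda>\<nu>. {i\<in>slots \<pi>. fst i = \<nu>}"
  note fin = finite_slots[OF assms(1)]
  define C where "C = (\<lambda>(\<nu>, j). coeff (\<Prod>i\<in>?A \<nu>. [: - g i, 1 :]) j)"
  have "\<exists>\<kappa>. \<kappa> \<noteq> 0 \<and> form_values (N_var \<pi>) F (conf \<pi> (\<lambda>i. poly (g i) t))
      = (\<lambda>i. \<kappa> * poly (peval_curve (F i) C) t)" for t
  proof -
    let ?x = "conf \<pi> (\<lambda>i. poly (g i) t)"
    have "\<exists>l. l \<noteq> 0 \<and> (\<nu> \<in> types \<pi> \<longrightarrow> (\<forall>j. pcoord (Sym_coord (?x \<nu>)) j = l * poly (C (\<nu>, j)) t))" for \<nu>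
    proof (cases "\<nu> \<in> types \<pi>")
      case True
      let ?Q = "\<Prod>i\<in>?A \<nu>. [: - poly (g i) t, 1 :]"
      have "coeff ?Q \<noteq> (\<lambda>_. 0)" using fin by (intro coeff_nonzero) simp
      then obtain l where "l \<noteq> 0" "pcoord (pclass (coeff ?Q)) = (\<lambda>j. l * coeff ?Q j)"
        by (rule pcoord_pclass)
      then show ?thesis
        using fin True by (intro exI[of _ l]) (simp add: C_def poly_coeff_prod_linear Sym_coord_config)
    qed (auto intro: exI[of _ 1])
    then obtain l where l: "\<And>\<nu>. l \<nu> \<noteq> 0"
      "\<And>\<nu> j. \<nu> \<in> types \<pi> \<Longrightarrow> pcoord (Sym_coord (?x \<nu>)) j = l \<nu> * poly (C (\<nu>, j)) t" by metis
    have "form_values (N_var \<pi>) F ?x i = (\<Prod>\<nu>\<in>types \<pi>. l \<nu> ^ D \<nu>) * poly (peval_curve (F i) C) t" for i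
    proof -
      have "fst v \<in> types \<pi>" if "s \<in> Poly_Mapping.keys (F i)" "v \<in> Poly_Mapping.keys s" for s v
        using assms(2)[of i] that by (auto simp: multihomogeneous_def)
      then have "form_values (N_var \<pi>) F ?x i = peval (F i) (\<lambda>(\<nu>, j). l \<nu> * poly (C (\<nu>, j)) t)"
        unfolding form_values_def peval_def
        by (intro sum.cong prod.cong refl arg_cong2[where f = "(*)"] arg_cong2[where f = "(^)"])
          (auto simp: N_var_def l(2) split: prod.split)
      also have "\<dots> = (\<Prod>\<nu>\<in>types \<pi>. l \<nu> ^ D \<nu>) * peval (F i) (\<lambda>(\<nu>, j). poly (C (\<nu>, j)) t)"
        by (rule peval_multihomogeneous_scale[OF assms])
      finally show ?thesis by (simp add: poly_peval_curve case_prod_unfold)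
    qed
    then show ?thesis
      using l(1) assms(1) by (intro exI[of _ "\<Prod>\<nu>\<in>types \<pi>. l \<nu> ^ D \<nu>"]) auto
  qed
  then show ?thesis by (intro exI[of _ "\<lambda>i. peval_curve (F i) C"]) blast
qed

text \<open>
  The cross products vanish at infinitely many points, hence identically.  Zeros of \<open>P i0\<close>
  have to be excluded, as the forms that define a regular map locally may all vanish there; multiplying the
  cross products by \<open>P i0\<close> takes care of them.
\<close>

lemma proportional_on_infinite_set:
  fixes P G :: "nat \<Rightarrow> 'a::field poly"
  assumes "infinite A" "P i0 \<noteq> 0"
    and "\<And>t. t \<in> A \<Longrightarrow> poly (P i0) t \<noteq> 0 \<Longrightarrow> \<exists>c. \<forall>i. poly (P i) t = c * poly (G i) t"
  shows "P i * G j = P j * G i"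
proof -
  define R where "R = (P i * G j - P j * G i) * P i0"
  have "poly R t = 0" if "t \<in> A" for t
  proof (cases "poly (P i0) t = 0")
    case False
    then obtain c where "\<forall>i. poly (P i) t = c * poly (G i) t" using assms(3) \<open>t \<in> A\<close> by blast
    then show ?thesis by (simp add: R_def)
  qed (simp add: R_def)
  then have "A \<subseteq> {t. poly R t = 0}" by blast
  then have "R = 0" using assms(1) poly_roots_finite[of R] finite_subset by blast
  then show ?thesis using assms(2) by (simp add: R_def)
qed

text \<open>
  The finitely many distributions cover the infinitely many points of a curve, so one of
  them occurs infinitely often.  Where it occurs, the lift is given both by local forms and by the
  coefficients of the redistributed linear factors; both are polynomial in \<open>t\<close>, so they remain
  proportional at every point of the curve where the local forms do not all vanish.
\<close>

lemma same_assignment_along_curve: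
  fixes \<zeta> :: "'a::field_char_0"
  assumes "primitive_root d \<zeta>" "d > 0" "finite (types \<pi>)" "finite (types \<pi>')"
    and reg: "regular_map (N_var \<pi>) (N_var \<pi>') \<psi>t"
    and q: "\<And>x. x \<in> pts (N_var \<pi>) \<Longrightarrow> q_hat d \<pi>' (\<psi>t x) = q_hat d \<pi> x"
  shows "\<exists>\<tau>\<in>slots \<pi> \<rightarrow>\<^sub>E types \<pi>'. \<exists>e\<in>slots \<pi> \<rightarrow>\<^sub>E {..<d}. \<forall>t.
    \<psi>t (conf \<pi> (\<lambda>i. poly (g i) t)) = config (types \<pi>') (slots \<pi>) \<tau> (\<lambda>i. \<zeta> ^ e i * poly (g i) t)"
proof -
  let ?I = "slots \<pi>" and ?T = "types \<pi>'"
  let ?x = "\<lambda>t. conf \<pi> (\<lambda>i. poly (g i) t)"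
  define valid where "valid = (\<lambda>t (\<tau>, e). \<psi>t (?x t) = config ?T ?I \<tau> (\<lambda>i. \<zeta> ^ e i * poly (g i) t))"
  note fin = finite_slots[OF assms(3)]
  have mapsto: "\<psi>t (conf \<pi> u) \<in> pts (N_var \<pi>')" for u
    using reg conf_in_N by (auto simp: regular_map_def)
  have ex: "\<exists>\<alpha>\<in>(?I \<rightarrow>\<^sub>E ?T) \<times> (?I \<rightarrow>\<^sub>E {..<d}). valid t \<alpha>" for t
    using assignment_at_point[OF assms(1-4) mapsto q[OF conf_in_N]] by (auto simp: valid_def)
  have "\<exists>\<alpha>\<in>(?I \<rightarrow>\<^sub>E ?T) \<times> (?I \<rightarrow>\<^sub>E {..<d}). infinite {t \<in> UNIV. valid t \<alpha>}"
    using ex fin assms(4) by (intro pigeonhole_infinite_rel finite_cartesian_product finite_PiE) (auto simp: infinite_UNIV_char_0)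
  then obtain \<tau> e where \<alpha>: "\<tau> \<in> ?I \<rightarrow>\<^sub>E ?T" "e \<in> ?I \<rightarrow>\<^sub>E {..<d}" "infinite {t. valid t (\<tau>, e)}" by auto
  have "valid t1 (\<tau>, e)" for t1
  proof -
    obtain \<tau>1 e1 where \<alpha>1: "valid t1 (\<tau>1, e1)" using ex[of t1] by auto
    have "\<psi>t (?x t1) \<nu> = config ?T ?I \<tau> (\<lambda>i. \<zeta> ^ e i * poly (g i) t1) \<nu>" if \<nu>: "\<nu> \<in> ?T" for \<nu>
    proof -
      let ?A = "{i\<in>?I. \<tau> i = \<nu>}" and ?A1 = "{i\<in>?I. \<tau>1 i = \<nu>}"
      obtain F D where F: "\<And>i. multihomogeneous (types \<pi>) D (F i)"
        "form_values (N_var \<pi>) F (?x t1) \<noteq> (\<lambda>_. 0)"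
        "\<And>y. y \<in> pts (N_var \<pi>) \<Longrightarrow> form_values (N_var \<pi>) F y \<noteq> (\<lambda>_. 0) \<Longrightarrow>
           Sym_coord (\<psi>t y \<nu>) = pclass (form_values (N_var \<pi>) F y)"
        using reg conf_in_N[of \<pi> "\<lambda>i. poly (g i) t1"] \<nu> unfolding regular_map_def
        by (force simp: N_var_def)
      obtain P where P: "\<And>t. \<exists>\<kappa>. \<kappa> \<noteq> 0 \<and> form_values (N_var \<pi>) F (?x t) = (\<lambda>i. \<kappa> * poly (P i) t)"
        using form_values_along_curve[where F = F and g = g, OF assms(3) F(1)] by blast
      have SymP: "Sym_coord (\<psi>t (?x t) \<nu>) = pclass (\<lambda>i. poly (P i) t)" if "poly (P i) t \<noteq> 0" for t i
      proof -
        obtain \<kappa> where "\<kappa> \<noteq> 0" "form_values (N_var \<pi>) F (?x t) = (\<lambda>i. \<kappa> * poly (P i) t)" using P by blast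
        moreover from this have "form_values (N_var \<pi>) F (?x t) \<noteq> (\<lambda>_. 0)" using that by (auto simp: fun_eq_iff)
        ultimately show ?thesis using F(3)[OF conf_in_N, of "\<lambda>i. poly (g i) t"] pclass_scale[of \<kappa> "\<lambda>i. poly (P i) t"] by simp
      qed
      obtain i0 where i0: "poly (P i0) t1 \<noteq> 0" using P[of t1] F(2) by (auto simp: fun_eq_iff)
      define G where "G = coeff (\<Prod>i\<in>?A. [: - smult (\<zeta> ^ e i) (g i), 1 :])"
      have G: "(\<lambda>j. poly (G j) t) = coeff (\<Prod>i\<in>?A. [: - (\<zeta> ^ e i * poly (g i) t), 1 :])" for t
        unfolding G_def using fin by (simp add: poly_coeff_prod_linear del: minus_mult_right mult_minus_right)
      have G0: "(\<lambda>j. poly (G j) t) \<noteq> (\<lambda>_. 0)" for t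
        unfolding G using fin by (intro coeff_nonzero) simp
      \<comment> \<open>At the infinitely many \<open>t\<close> with distribution \<open>(\<tau>, e)\<close>, the forms \<open>P\<close> and \<open>G\<close> represent the same point.\<close>
      have cross: "P i * G j = P j * G i" for i j
      proof (rule proportional_on_infinite_set[OF \<alpha>(3)])
        show "P i0 \<noteq> 0" using i0 by auto
      next
        fix t assume t: "t \<in> {t. valid t (\<tau>, e)}" "poly (P i0) t \<noteq> 0"
        have "pclass (\<lambda>i. poly (P i) t) = pclass (\<lambda>j. poly (G j) t)"
          unfolding G Sym_coord_config[OF fin \<nu>, symmetric]
          using SymP[OF t(2)] t(1) by (simp add: valid_def)
        moreover have "(\<lambda>i. poly (P i) t) \<noteq> (\<lambda>_. 0)" using t(2) by (auto simp: fun_eq_iff)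
        ultimately obtain c where "(\<lambda>i. poly (P i) t) = (\<lambda>i. c * poly (G i) t)"
          using pclass_eq_iff[OF G0[of t], of "\<lambda>i. poly (P i) t"] by auto
        then show "\<exists>c. \<forall>i. poly (P i) t = c * poly (G i) t" by (auto simp: fun_eq_iff)
      qed
      obtain j where j: "poly (G j) t1 \<noteq> 0" using G0[of t1] by (auto simp: fun_eq_iff)
      let ?c = "poly (P j) t1 / poly (G j) t1"
      have ratio: "poly (P i) t1 = ?c * poly (G i) t1" for i
        using arg_cong[OF cross[of i j], of "\<lambda>p. poly p t1"] j by (simp add: field_simps)
      have "?c \<noteq> 0" using ratio[of i0] i0 by auto
      have "Sym_coord (\<psi>t (?x t1) \<nu>) = pclass (\<lambda>j. poly (G j) t1)"
        unfolding SymP[OF i0] ext[of "\<lambda>i. poly (P i) t1", OF ratio] by (rule pclass_scale[OF \<open>?c \<noteq> 0\<close>])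
      \<comment> \<open>At \<open>t1\<close> there is also some distribution, so all points are affine and can be recovered from the roots.\<close>
      moreover have "Sym_coord (\<psi>t (?x t1) \<nu>) = pclass (coeff (\<Prod>i\<in>?A1. [: - (\<zeta> ^ e1 i * poly (g i) t1), 1 :]))"
        using \<alpha>1 Sym_coord_config[OF fin \<nu>] by (simp add: valid_def)
      ultimately have "pclass (coeff (\<Prod>i\<in>?A. [: - (\<zeta> ^ e i * poly (g i) t1), 1 :])) =
          pclass (coeff (\<Prod>i\<in>?A1. [: - (\<zeta> ^ e1 i * poly (g i) t1), 1 :]))" by (simp add: G)
      then have "proots (\<Prod>i\<in>?A. [: - (\<zeta> ^ e i * poly (g i) t1), 1 :]) =
          proots (\<Prod>i\<in>?A1. [: - (\<zeta> ^ e1 i * poly (g i) t1), 1 :])"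
        using fin by (intro pclass_coeff_eq_imp_proots_eq) auto
      then have "image_mset (\<lambda>i. \<zeta> ^ e1 i * poly (g i) t1) (mset_set ?A1) =
          image_mset (\<lambda>i. \<zeta> ^ e i * poly (g i) t1) (mset_set ?A)"
        using fin by (simp add: proots_prod_linear)
      from arg_cong[OF this, of "image_mset aff"] show ?thesis
        using \<alpha>1 \<nu> by (simp add: valid_def config_def image_mset.compositionality o_def)
    qed
    moreover have "\<psi>t (?x t1) \<in> extensional ?T"
      using mapsto[of "\<lambda>i. poly (g i) t1"] by (auto simp: N_var_def PiE_iff)
    moreover have "config ?T ?I \<tau> (\<lambda>i. \<zeta> ^ e i * poly (g i) t1) \<in> extensional ?T" by (simp add: config_def)
    ultimately show ?thesis unfolding valid_def by (auto intro: extensionalityI)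
  qed
  then show ?thesis using \<alpha>(1,2) by (auto simp: valid_def)
qed

text \<open>
  Every \<open>u\<close> is joined by a line to the base point \<open>b\<close>, where the distribution is unique.  So the
  distribution found on each of these lines is the one at \<open>b\<close>.
\<close>

lemma lift_rigid:
  fixes \<zeta> :: "'a::field_char_0"
  assumes "primitive_root d \<zeta>" "d > 0" "finite (types \<pi>)" "finite (types \<pi>')"
    and "regular_map (N_var \<pi>) (N_var \<pi>') \<psi>t"
    and "\<And>x. x \<in> pts (N_var \<pi>) \<Longrightarrow> q_hat d \<pi>' (\<psi>t x) = q_hat d \<pi> x"
  obtains \<tau> e where "\<tau> \<in> slots \<pi> \<rightarrow> types \<pi>'"
    "\<And>u. \<psi>t (conf \<pi> u) = config (types \<pi>') (slots \<pi>) \<tau> (\<lambda>i. \<zeta> ^ e i * u i)"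
proof -
  let ?I = "slots \<pi>" and ?T = "types \<pi>'"
  note fin = finite_slots[OF assms(3)]
  obtain h :: "_ \<Rightarrow> nat" where h: "inj_on h ?I" using finite_imp_inj_to_nat_seg[OF fin] by blast
  \<comment> \<open>Positive integers: in characteristic zero, their \<open>d\<close>-th powers are nonzero and distinct.\<close>
  define b :: "_ \<Rightarrow> 'a" where "b = (\<lambda>i. of_nat (Suc (h i)))"
  have "b i \<noteq> 0" for i unfolding b_def of_nat_eq_0_iff by simp
  have "inj_on (\<lambda>i. b i ^ d) ?I"
  proof (rule inj_onI)
    fix i j assume "i \<in> ?I" "j \<in> ?I" "b i ^ d = b j ^ d"
    then have "Suc (h i) ^ d = Suc (h j) ^ d" unfolding b_def by (metis of_nat_eq_iff of_nat_power)
    then have "h i = h j" using assms(2) by (metis Suc_inject power_eq_imp_eq_base zero_le)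
    then show "i = j" using h \<open>i \<in> ?I\<close> \<open>j \<in> ?I\<close> by (auto dest: inj_onD)
  qed
  note uniq = assignment_unique[OF assms(1,2) fin _ _ _ _ this \<open>\<And>i. b i \<noteq> 0\<close>]
  have line: "\<exists>\<tau>\<in>?I \<rightarrow>\<^sub>E ?T. \<exists>e\<in>?I \<rightarrow>\<^sub>E {..<d}.
      \<psi>t (conf \<pi> b) = config ?T ?I \<tau> (\<lambda>i. \<zeta> ^ e i * b i) \<and>
      \<psi>t (conf \<pi> u) = config ?T ?I \<tau> (\<lambda>i. \<zeta> ^ e i * u i)" for u
  proof -
    obtain \<tau> e where *: "\<tau>\<in>?I \<rightarrow>\<^sub>E ?T" "e\<in>?I \<rightarrow>\<^sub>E {..<d}"
      "\<And>t. \<psi>t (conf \<pi> (\<lambda>i. poly [: b i, u i - b i :] t)) =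
        config ?T ?I \<tau> (\<lambda>i. \<zeta> ^ e i * poly [: b i, u i - b i :] t)"
      using same_assignment_along_curve[OF assms, of "\<lambda>i. [: b i, u i - b i :]"] by blast
    from *(3)[of 0] *(3)[of 1] *(1,2) show ?thesis by auto
  qed
  obtain \<tau> e where base: "\<tau>\<in>?I \<rightarrow>\<^sub>E ?T" "e\<in>?I \<rightarrow>\<^sub>E {..<d}"
    "\<psi>t (conf \<pi> b) = config ?T ?I \<tau> (\<lambda>i. \<zeta> ^ e i * b i)" using line[of b] by blast
  have "\<psi>t (conf \<pi> u) = config ?T ?I \<tau> (\<lambda>i. \<zeta> ^ e i * u i)" for u
  proof -
    obtain \<tau>' e' where *: "\<tau>'\<in>?I \<rightarrow>\<^sub>E ?T" "e'\<in>?I \<rightarrow>\<^sub>E {..<d}"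
      "\<psi>t (conf \<pi> b) = config ?T ?I \<tau>' (\<lambda>i. \<zeta> ^ e' i * b i)"
      "\<psi>t (conf \<pi> u) = config ?T ?I \<tau>' (\<lambda>i. \<zeta> ^ e' i * u i)" using line[of u] by blast
    have "\<tau> = \<tau>'" "e = e'"
      by (rule uniq[OF base(1) *(1) base(2) *(2)]; use base(3) *(3) in simp)+
    with *(4) show ?thesis by simp
  qed
  with base(1) that show thesis by (auto simp: PiE_def)
qed

section \<open>The lift preserves necklaces and multiplicities\<close>

text \<open>
  The assumption on \<open>\<psi>\<close> says that the image of \<open>u\<close> under \<open>f\<^sub>\<pi>\<close> determines the image of its redistribution
  under \<open>f\<^sub>\<pi>\<^sub>'\<close>.  In the group ring of \<open>C\<^sub>d\<close>, with subsets
  read as sums, the relation \<open>[S] = \<Sum>\<^sub>a\<^sub>\<in>\<^sub>S \<zeta>\<^sup>a [{0}]\<close> between types of \<open>\<pi>\<close> is transported to the types of \<open>\<pi>'\<close>: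
  the contribution of each type is the corresponding \<open>S\<close> times a fixed
  element \<open>B\<close>.  As some contribution is a monomial, so is \<open>B\<close>.
\<close>

lemma lift_preserves_necklaces:
  fixes \<zeta> :: "'a::field_char_0" and \<pi> :: "'i profile" and \<pi>' :: "'j profile"
  assumes "d > 0" and \<zeta>: "primitive_root d \<zeta>"
    and prof: "is_profile d m \<pi>" "is_profile d m' \<pi>'"
    and single: "\<nu>0 \<in> types \<pi>" "necklace d (rep \<pi> \<nu>0) = necklace d {0}" "d \<le> mult \<pi> \<nu>0"
    and single': "\<nu>1 \<in> types \<pi>'" "necklace d (rep \<pi>' \<nu>1) = necklace d {0}"
    and \<tau>: "\<tau> \<in> slots \<pi> \<rightarrow> types \<pi>'"
    and surj: "types \<pi>' \<subseteq> \<tau> ` slots \<pi>"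
    and \<psi>: "\<And>u. f_map \<zeta> \<pi>' (config (types \<pi>') (slots \<pi>) \<tau> (\<lambda>i. \<zeta> ^ e i * u i)) = \<psi> (f_map \<zeta> \<pi> (conf \<pi> u))"
    and i: "i \<in> slots \<pi>"
  shows "necklace d (rep \<pi>' (\<tau> i)) = necklace d (rep \<pi> (fst i))"
proof -
  let ?I = "slots \<pi>"
  have \<zeta>0: "\<zeta> \<noteq> 0" by (rule primitive_root_nonzero[OF \<zeta> assms(1)])
  have \<zeta>d: "(\<zeta> ^ k) ^ d = 1" for k
    by (rule primitive_root_power_power[OF \<zeta>])
  have types: "finite (types \<pi>)" "finite (types \<pi>')" using prof by (auto simp: is_profile_def)
  note fin = finite_slots[OF types(1)]
  have rep: "\<And>\<nu>. \<nu> \<in> types \<pi> \<Longrightarrow> rep \<pi> \<nu> \<subseteq> {..<d}" "\<And>\<nu>. \<nu> \<in> types \<pi>' \<Longrightarrow> rep \<pi>' \<nu> \<subseteq> {..<d}"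
    using prof by (auto simp: is_profile_def)
  then have finrep: "\<And>\<nu>. \<nu> \<in> types \<pi> \<Longrightarrow> finite (rep \<pi> \<nu>)" "\<And>\<nu>. \<nu> \<in> types \<pi>' \<Longrightarrow> finite (rep \<pi>' \<nu>)"
    by (meson finite_lessThan finite_subset)+
  define R where "R = (\<lambda>i :: 'i \<times> nat. rep \<pi> (fst i))"
  define E where "E = (\<lambda>i :: 'i \<times> nat. image_mset (\<lambda>a. \<zeta> ^ a * \<zeta> ^ e i) (mset_set (rep \<pi>' (\<tau> i))))"
  have E_roots: "(\<Sum>i\<in>J. image_mset (\<lambda>z. z * u i) (E i)) = roots \<zeta> J (\<lambda>i. rep \<pi>' (\<tau> i)) (\<lambda>i. \<zeta> ^ e i * u i)" for J u
    by (simp add: roots_def E_def image_mset.compositionality o_def mult.assoc)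

  \<comment> \<open>\<open>u\<close> and \<open>v\<close> are extended by \<open>0\<close> outside \<open>J\<close> and \<open>J'\<close>; the numbers of zero roots agree for reasons of degree.\<close>
  have transfer: "(\<Sum>i\<in>J. image_mset (\<lambda>z. z * u i) (E i)) = (\<Sum>i\<in>J'. image_mset (\<lambda>z. z * v i) (E i))"
    if J: "J \<subseteq> ?I" "\<And>i. i \<in> J \<Longrightarrow> u i \<noteq> 0" and J': "J' \<subseteq> ?I" "\<And>i. i \<in> J' \<Longrightarrow> v i \<noteq> 0"
      and eq: "roots \<zeta> J R u = roots \<zeta> J' R v" for J J' u v
  proof -
    define u' where "u' = (\<lambda>i. if i \<in> J then u i else 0)"
    define v' where "v' = (\<lambda>i. if i \<in> J' then v i else 0)"
    have r: "roots \<zeta> J A u' = roots \<zeta> J A u" "roots \<zeta> J' A v' = roots \<zeta> J' A v" for A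
      by (auto simp: roots_def u'_def v'_def)
    have "filter_mset (\<lambda>z. z \<noteq> 0) (roots \<zeta> ?I R u') = filter_mset (\<lambda>z. z \<noteq> 0) (roots \<zeta> ?I R v')"
      using nonzero_roots[OF \<zeta>0 fin J(1), of u' R] nonzero_roots[OF \<zeta>0 fin J'(1), of v' R] J(2) J'(2) eq r
      by (simp add: u'_def v'_def)
    then have "roots \<zeta> ?I R u' = roots \<zeta> ?I R v'"
      by (rule mset_eq_if_nonzero_parts_eq) (simp add: size_roots)
    then have "f_map \<zeta> \<pi> (conf \<pi> u') = f_map \<zeta> \<pi> (conf \<pi> v')"
      using f_map_config_eq_iff[OF fin types(1) fst_slots finrep(1), of \<zeta>] unfolding R_def by blast
    then have "f_map \<zeta> \<pi>' (config (types \<pi>') ?I \<tau> (\<lambda>i. \<zeta> ^ e i * u' i)) =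
        f_map \<zeta> \<pi>' (config (types \<pi>') ?I \<tau> (\<lambda>i. \<zeta> ^ e i * v' i))" by (simp only: \<psi>)
    moreover have "\<tau> ` ?I \<subseteq> types \<pi>'" using \<tau> by auto
    ultimately have "roots \<zeta> ?I (\<lambda>i. rep \<pi>' (\<tau> i)) (\<lambda>i. \<zeta> ^ e i * u' i) = roots \<zeta> ?I (\<lambda>i. rep \<pi>' (\<tau> i)) (\<lambda>i. \<zeta> ^ e i * v' i)"
      using f_map_config_eq_iff[OF fin types(2) _ finrep(2), of \<tau> \<zeta>] by blast
    then have "roots \<zeta> J (\<lambda>i. rep \<pi>' (\<tau> i)) (\<lambda>i. \<zeta> ^ e i * u' i) = roots \<zeta> J' (\<lambda>i. rep \<pi>' (\<tau> i)) (\<lambda>i. \<zeta> ^ e i * v' i)"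
      using nonzero_roots[OF \<zeta>0 fin J(1), of "\<lambda>i. \<zeta> ^ e i * u' i" "\<lambda>i. rep \<pi>' (\<tau> i)"]
        nonzero_roots[OF \<zeta>0 fin J'(1), of "\<lambda>i. \<zeta> ^ e i * v' i" "\<lambda>i. rep \<pi>' (\<tau> i)"] J(2) J'(2) \<zeta>0
      by (simp add: u'_def v'_def)
    moreover have "roots \<zeta> J A (\<lambda>i. \<zeta> ^ e i * u' i) = roots \<zeta> J A (\<lambda>i. \<zeta> ^ e i * u i)"
      "roots \<zeta> J' A (\<lambda>i. \<zeta> ^ e i * v' i) = roots \<zeta> J' A (\<lambda>i. \<zeta> ^ e i * v i)" for A
      by (auto simp: roots_def u'_def v'_def)
    ultimately show ?thesis unfolding E_roots by metis
  qed

  obtain c where c: "rep \<pi> \<nu>0 = {c}"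
    using necklace_singleton[OF assms(1) rep(1)[OF single(1)] single(2)] by blast
  define B where "B = E (\<nu>0, 0)"
  have slot0: "(\<nu>0, j) \<in> ?I" if "j < d" for j
    using single(1,3) that by (auto simp: slots_def)
  \<comment> \<open>Slots of the same type are interchangeable.\<close>
  have EB: "E (\<nu>0, j) = B" if "j < d" for j
    using transfer[of "{(\<nu>0, j)}" "\<lambda>_. 1" "{(\<nu>0, 0)}" "\<lambda>_. 1"] slot0 that assms(1)
    by (simp add: B_def roots_def R_def)

  have E: "E k = (\<Sum>a\<in>rep \<pi> (fst k). image_mset (\<lambda>z. z * (\<zeta> ^ a / \<zeta> ^ c)) B)" if k: "k \<in> ?I" for k
  proof -
    let ?S = "rep \<pi> (fst k)"
    have "fst k \<in> types \<pi>" using k by (auto simp: slots_def)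
    note S = rep(1)[OF this] finrep(1)[OF this]
    then have card: "card ?S \<le> d" using card_mono[OF _ S(1)] by simp
    obtain g where g: "bij_betw g {..<card ?S} ?S"
      using ex_bij_betw_nat_finite[OF S(2)] by (auto simp: atLeast0LessThan)
    define v where "v = (\<lambda>i :: 'i \<times> nat. \<zeta> ^ g (snd i) / \<zeta> ^ c)"
    let ?J = "Pair \<nu>0 ` {..<card ?S}"
    have inj: "inj_on (Pair \<nu>0) A" for A by (auto simp: inj_on_def)
    \<comment> \<open>The representative of the singleton type is \<open>{c}\<close>, so a point \<open>w\<close> there has the root \<open>\<zeta>\<^sup>c w\<close>.\<close>
    have "roots \<zeta> ?J R v = (\<Sum>j<card ?S. {# \<zeta> ^ g j #})"
      using \<zeta>0 by (simp add: roots_def sum.reindex[OF inj] o_def R_def c v_def)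
    also have "\<dots> = (\<Sum>a\<in>?S. {# \<zeta> ^ a #})"
      using sum.reindex_bij_betw[OF g, of "\<lambda>a. {# \<zeta> ^ a #}"] by simp
    also have "\<dots> = roots \<zeta> {k} R (\<lambda>_. 1)"
      using S(2) by (simp add: roots_def R_def sum_single_mset)
    finally have "(\<Sum>i\<in>{k}. image_mset (\<lambda>z. z * 1) (E i)) = (\<Sum>i\<in>?J. image_mset (\<lambda>z. z * v i) (E i))"
      using k slot0 card \<zeta>0 by (intro transfer) (auto simp: v_def)
    also have "\<dots> = (\<Sum>j<card ?S. image_mset (\<lambda>z. z * (\<zeta> ^ g j / \<zeta> ^ c)) B)"
      using card by (simp add: sum.reindex[OF inj] o_def v_def EB)
    also have "\<dots> = (\<Sum>a\<in>?S. image_mset (\<lambda>z. z * (\<zeta> ^ a / \<zeta> ^ c)) B)"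
      by (rule sum.reindex_bij_betw[OF g, of "\<lambda>a. image_mset (\<lambda>z. z * (\<zeta> ^ a / \<zeta> ^ c)) B"])
    finally show ?thesis by simp
  qed

  \<comment> \<open>A slot that is sent to the singleton type forces \<open>B\<close> to have a single element.\<close>
  obtain k where k: "k \<in> ?I" "\<tau> k = \<nu>1" using surj single'(1) by auto
  obtain c' where "rep \<pi>' \<nu>1 = {c'}"
    using necklace_singleton[OF assms(1) rep(2)[OF single'(1)] single'(2)] by blast
  then have "size (E k) = 1" by (simp add: E_def k(2))
  moreover have "size (E k) = card (rep \<pi> (fst k)) * size B" unfolding E[OF k(1)] by simp
  ultimately have "size B = 1" by simp
  then obtain \<beta> where \<beta>: "B = {#\<beta>#}" using size_1_singleton_mset by blast
  then have "\<beta> \<in># E (\<nu>0, 0)" by (simp add: B_def)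
  then obtain a0 where "\<beta> = \<zeta> ^ a0 * \<zeta> ^ e (\<nu>0, 0)" by (auto simp: E_def)
  then have "\<beta> ^ d = 1" by (simp add: power_mult_distrib \<zeta>d)

  define z where "z = \<beta> / (\<zeta> ^ c * \<zeta> ^ e i)"
  have "z ^ d = 1" using \<open>\<beta> ^ d = 1\<close> by (simp add: z_def power_divide power_mult_distrib \<zeta>d)
  have types_i: "fst i \<in> types \<pi>" "\<tau> i \<in> types \<pi>'" using i \<tau> by (auto simp: slots_def)
  have "set_mset (E i) = (\<lambda>a. \<beta> * (\<zeta> ^ a / \<zeta> ^ c)) ` rep \<pi> (fst i)"
    unfolding E[OF i] \<beta> using finrep(1)[OF types_i(1)] by (auto simp: set_mset_sum)
  moreover have "set_mset (E i) = (\<lambda>a. \<zeta> ^ a * \<zeta> ^ e i) ` rep \<pi>' (\<tau> i)"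
    using finrep(2)[OF types_i(2)] by (simp add: E_def)
  ultimately have "(\<lambda>x. x / \<zeta> ^ e i) ` (\<lambda>a. \<zeta> ^ a * \<zeta> ^ e i) ` rep \<pi>' (\<tau> i) =
      (\<lambda>x. x / \<zeta> ^ e i) ` (\<lambda>a. \<beta> * (\<zeta> ^ a / \<zeta> ^ c)) ` rep \<pi> (fst i)" by simp
  then have "(\<lambda>a. \<zeta> ^ a) ` rep \<pi>' (\<tau> i) = (\<lambda>a. z * \<zeta> ^ a) ` rep \<pi> (fst i)"
    unfolding image_image z_def using \<zeta>0 by (simp add: field_simps)
  then obtain s where "s < d" "rep \<pi>' (\<tau> i) = translate d s (rep \<pi> (fst i))"
    using translate_from_powers[OF \<zeta> assms(1) rep(2)[OF types_i(2)] \<open>z ^ d = 1\<close>] by blast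
  then show ?thesis using necklace_translate[OF assms(1)] by simp
qed

text \<open>
  Distinct types have distinct invariants \<open>N\<close>, so \<open>\<tau>\<close> can only depend on the type of a
  slot.
\<close>

lemma profile_bijection:
  assumes inj: "inj_on N (types \<pi>)" "inj_on N' (types \<pi>')"
    and \<tau>: "\<tau> \<in> slots \<pi> \<rightarrow> types \<pi>'"
    and N: "\<And>i. i \<in> slots \<pi> \<Longrightarrow> N' (\<tau> i) = N (fst i)"
    and card: "\<And>\<nu>. \<nu> \<in> types \<pi>' \<Longrightarrow> card {i\<in>slots \<pi>. \<tau> i = \<nu>} = mult \<pi>' \<nu>"
    and pos: "\<And>\<nu>. \<nu> \<in> types \<pi> \<Longrightarrow> 0 < mult \<pi> \<nu>"
    and surj: "types \<pi>' \<subseteq> \<tau> ` slots \<pi>"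
  shows "\<exists>\<sigma>. bij_betw \<sigma> (types \<pi>) (types \<pi>') \<and>
    (\<forall>\<nu>\<in>types \<pi>. N' (\<sigma> \<nu>) = N \<nu> \<and> mult \<pi>' (\<sigma> \<nu>) = mult \<pi> \<nu>)"
proof -
  define \<sigma> where "\<sigma> = (\<lambda>\<nu>. \<tau> (\<nu>, 0))"
  have s0: "(\<nu>, 0) \<in> slots \<pi>" if "\<nu> \<in> types \<pi>" for \<nu> using that pos by (auto simp: slots_def)
  have \<sigma>: "\<sigma> \<nu> \<in> types \<pi>'" "N' (\<sigma> \<nu>) = N \<nu>" if "\<nu> \<in> types \<pi>" for \<nu>
    using s0[OF that] \<tau> N[OF s0[OF that]] by (auto simp: \<sigma>_def)
  have fst_in: "fst i \<in> types \<pi>" if "i \<in> slots \<pi>" for i using that by (auto simp: slots_def)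
  have \<tau>\<sigma>: "\<tau> i = \<sigma> (fst i)" if i: "i \<in> slots \<pi>" for i
  proof (rule inj_onD[OF inj(2)])
    show "N' (\<tau> i) = N' (\<sigma> (fst i))" using N[OF i] \<sigma>(2)[OF fst_in[OF i]] by simp
  qed (use \<tau> i \<sigma>(1) fst_in in auto)
  have inj\<sigma>: "inj_on \<sigma> (types \<pi>)"
    using inj(1) \<sigma>(2) by (metis inj_on_def)
  have "\<sigma> ` types \<pi> = types \<pi>'"
  proof
    show "types \<pi>' \<subseteq> \<sigma> ` types \<pi>" using surj \<tau>\<sigma> fst_in by fastforce
  qed (use \<sigma>(1) in auto)
  moreover have "mult \<pi>' (\<sigma> \<nu>) = mult \<pi> \<nu>" if \<nu>: "\<nu> \<in> types \<pi>" for \<nu>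
  proof -
    have "{i\<in>slots \<pi>. \<tau> i = \<sigma> \<nu>} = {i\<in>slots \<pi>. fst i = \<nu>}"
      using \<tau>\<sigma> inj_onD[OF inj\<sigma>] \<nu> fst_in by auto
    also have "\<dots> = Pair \<nu> ` {..<mult \<pi> \<nu>}" by (rule slots_fibre[OF \<nu>])
    finally show ?thesis using card[OF \<sigma>(1)[OF \<nu>]] by (simp add: card_image inj_on_def)
  qed
  ultimately show ?thesis using inj\<sigma> \<sigma>(2) by (auto simp: bij_betw_def)
qed

section \<open>Rotations\<close>

text \<open>
  The automorphism \<open>[u : v] \<mapsto> [u : z v]\<close> of \<open>\<bbbP>\<^sup>1\<close>, which divides the affine coordinate \<open>u / v\<close>
  by \<open>z\<close>.  Scaling every coordinate by \<open>z\<^sup>i\<close> lets the same formula describe the induced map on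
  binary forms of any degree.
\<close>

definition rot :: "'a::field \<Rightarrow> 'a proj \<Rightarrow> 'a proj" where
  "rot z p = pclass (\<lambda>i. z ^ i * pcoord p i)"

lemma pcoord_rot:
  assumes "z \<noteq> 0"
  obtains c where "c \<noteq> 0" "pcoord (rot z p) = (\<lambda>i. c * (z ^ i * pcoord p i))"
proof -
  have "(\<lambda>i. z ^ i * pcoord p i) \<noteq> (\<lambda>_. 0)"
    using pcoord_nonzero[of p] assms by (auto simp: fun_eq_iff)
  from pcoord_pclass[OF this] that show thesis unfolding rot_def by blast
qed

lemma rot_in_P1:
  assumes "z \<noteq> 0" "p \<in> proj_space 1"
  shows "rot z p \<in> proj_space 1"
proof -
  have "\<forall>i>1. z ^ i * pcoord p i = 0" using pcoord_beyond[OF assms(2)] by simp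
  moreover have "(\<lambda>i. z ^ i * pcoord p i) \<noteq> (\<lambda>_. 0)"
    using pcoord_nonzero[of p] assms(1) by (auto simp: fun_eq_iff)
  ultimately show ?thesis unfolding rot_def proj_space_def by blast
qed

lemma power_point_rot:
  assumes "z ^ d = 1" "z \<noteq> 0"
  shows "power_point d (rot z p) = power_point d p"
proof -
  obtain c where c: "c \<noteq> 0" "pcoord (rot z p) = (\<lambda>i. c * (z ^ i * pcoord p i))"
    by (rule pcoord_rot[OF assms(2)])
  have "(z ^ i) ^ d = 1" for i using assms(1) by (metis mult.commute power_mult power_one)
  then have "(\<lambda>i. pcoord (rot z p) i ^ d) = (\<lambda>i. c ^ d * pcoord p i ^ d)"
    by (simp add: c(2) power_mult_distrib)
  then show ?thesis
    unfolding power_point_def using pclass_scale[of "c ^ d" "\<lambda>i. pcoord p i ^ d"] c(1) by simp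
qed

text \<open>
  Each factor \<open>v X - \<zeta>\<^sup>a u Z\<close> is multiplied by \<open>\<zeta>\<^sup>t\<close>: translation adds \<open>t\<close> to the exponent of \<open>\<zeta>\<close> next to
  \<open>u\<close>, and the rotation supplies the same factor next to \<open>v\<close>.
\<close>

lemma orbit_form_rot:
  fixes \<zeta> :: "'a::field"
  assumes "primitive_root d \<zeta>" "d > 0" "S \<subseteq> {..<d}"
  shows "\<exists>c. c \<noteq> 0 \<and> orbit_form \<zeta> (translate d t S) (rot (\<zeta> ^ t) p) = smult c (orbit_form \<zeta> S p)"
proof -
  have \<zeta>0: "\<zeta> \<noteq> 0" by (rule primitive_root_nonzero[OF assms(1,2)])
  note mod = primitive_root_power_mod[OF assms(1)]
  have inj: "inj_on (\<lambda>a. (a + t) mod d) S"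
  proof (rule inj_onI)
    fix a b assume ab: "a \<in> S" "b \<in> S" "(a + t) mod d = (b + t) mod d"
    then have "\<zeta> ^ a * \<zeta> ^ t = \<zeta> ^ b * \<zeta> ^ t" using mod by (metis power_add)
    then show "a = b"
      using \<zeta>0 primitive_root_inj[OF assms(1,2)] ab assms(3) by (auto dest: inj_onD)
  qed
  obtain c where c: "c \<noteq> 0" "pcoord (rot (\<zeta> ^ t) p) = (\<lambda>i. c * ((\<zeta> ^ t) ^ i * pcoord p i))"
    using pcoord_rot[of "\<zeta> ^ t" p] \<zeta>0 by auto
  show ?thesis
    unfolding orbit_form_def translate_def prod.reindex[OF inj] o_def mod
  proof (rule prod_smult_ex)
    show "finite S" using assms(3) finite_subset by blast
    show "\<exists>c. c \<noteq> 0 \<and> [:- (\<zeta> ^ (a + t) * pcoord (rot (\<zeta> ^ t) p) 0), pcoord (rot (\<zeta> ^ t) p) 1:] =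
        smult c [:- (\<zeta> ^ a * pcoord p 0), pcoord p 1:]" for a
      using c \<zeta>0 by (intro exI[of _ "c * \<zeta> ^ t"]) (auto simp: power_add)
  qed
qed

lemma coeff_prod_rescaled:
  "coeff (\<Prod>p\<in>#M. [: a p, z * b p :]) i = z ^ i * coeff (\<Prod>p\<in>#M. [: a p, b p :]) (i :: nat)"
  for z :: "'a::field"
proof (induction M arbitrary: i)
  case empty
  then show ?case by (cases i) auto
next
  case (add p M)
  then show ?case by (cases i) (auto simp: algebra_simps)
qed

text \<open>
  Rotating all zeros of a binary form amounts to the substitution \<open>X \<mapsto> z X\<close>, which is diagonal in
  the coefficients.  This makes the induced map of symmetric powers regular.
\<close>

lemma Sym_coord_rot:
  assumes "z \<noteq> 0" "set_mset M \<subseteq> proj_space 1"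
  shows "Sym_coord (image_mset (rot z) M) = pclass (\<lambda>i. z ^ i * pcoord (Sym_coord M) i)"
proof -
  let ?P = "\<Prod>p\<in>#M. [: - pcoord p 0, pcoord p 1 :]"
  have "\<exists>c. c \<noteq> 0 \<and> (\<Prod>p\<in>#M. [: - pcoord (rot z p) 0, pcoord (rot z p) 1 :]) =
      smult c (\<Prod>p\<in>#M. [: - pcoord p 0, z * pcoord p 1 :])"
  proof (rule prod_mset_smult_ex)
    fix p
    obtain c where "c \<noteq> 0" "pcoord (rot z p) = (\<lambda>i. c * (z ^ i * pcoord p i))"
      by (rule pcoord_rot[OF assms(1)])
    then show "\<exists>c. c \<noteq> 0 \<and> [: - pcoord (rot z p) 0, pcoord (rot z p) 1 :] = smult c [: - pcoord p 0, z * pcoord p 1 :]"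
      by (intro exI[of _ c]) auto
  qed
  then have "Sym_coord (image_mset (rot z) M) = pclass (coeff (\<Prod>p\<in>#M. [: - pcoord p 0, z * pcoord p 1 :]))"
    by (auto simp: Sym_coord_def image_mset.compositionality o_def pclass_coeff_smult)
  also have "coeff (\<Prod>p\<in>#M. [: - pcoord p 0, z * pcoord p 1 :]) = (\<lambda>i. z ^ i * coeff ?P i)"
    by (rule ext) (rule coeff_prod_rescaled)
  finally have *: "Sym_coord (image_mset (rot z) M) = pclass (\<lambda>i. z ^ i * coeff ?P i)" .
  have "[: - pcoord p 0, pcoord p 1 :] \<noteq> 0" if "p \<in># M" for p
  proof
    assume 0: "[: - pcoord p 0, pcoord p 1 :] = 0"
    have "p \<in> proj_space 1" using assms(2) \<open>p \<in># M\<close> by blast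
    then have "pcoord p i = 0" for i
      using 0 pcoord_beyond[of p 1 i] by (cases "i = 0"; cases "i = 1") auto
    then show False using pcoord_nonzero[of p] by auto
  qed
  then have "?P \<noteq> 0" by (auto simp: prod_mset_zero_iff)
  then obtain c where c: "c \<noteq> 0" "pcoord (Sym_coord M) = (\<lambda>i. c * coeff ?P i)"
    using pcoord_pclass[OF coeff_nonzero] unfolding Sym_coord_def by blast
  then have "(\<lambda>i. z ^ i * pcoord (Sym_coord M) i) = (\<lambda>i. c * (z ^ i * coeff ?P i))" by auto
  then show ?thesis using * pclass_scale[OF c(1), of "\<lambda>i. z ^ i * coeff ?P i"] by simp
qed

lemma coordinate_form:
  fixes c :: "'a::field"
  assumes "c \<noteq> 0" "k \<in> K"
  shows "multihomogeneous K (\<lambda>l. if l = k then 1 else 0) (Poly_Mapping.single (Poly_Mapping.single (k, i) 1) c)"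
    and "peval (Poly_Mapping.single (Poly_Mapping.single (k, i) 1) c) X = c * X (k, i)"
proof -
  have "{v. v = (k, i) \<and> fst v = l} = (if l = k then {(k, i)} else {})" for l by auto
  then show "multihomogeneous K (\<lambda>l. if l = k then 1 else 0) (Poly_Mapping.single (Poly_Mapping.single (k, i) 1) c)"
    using assms by (auto simp: multihomogeneous_def)
  show "peval (Poly_Mapping.single (Poly_Mapping.single (k, i) 1) c) X = c * X (k, i)"
    using assms by (simp add: peval_def)
qed

text \<open>
  Rotate the factor of type \<open>\<nu>\<close> by \<open>\<zeta>\<^sup>t\<close>, where \<open>t\<close> is a translation that takes the
  representative of \<open>\<nu>\<close> to the one of \<open>\<sigma> \<nu>\<close>.
\<close>

lemma rotation_lift:
  fixes \<zeta> :: "'a::field" and \<pi> :: "'i profile" and \<pi>' :: "'j profile"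
  assumes "d > 0" and \<zeta>: "primitive_root d \<zeta>"
    and prof: "is_profile d m \<pi>" "is_profile d m' \<pi>'"
    and \<sigma>: "bij_betw \<sigma> (types \<pi>) (types \<pi>')"
    and N: "\<And>\<nu>. \<nu> \<in> types \<pi> \<Longrightarrow> necklace d (rep \<pi>' (\<sigma> \<nu>)) = necklace d (rep \<pi> \<nu>)"
    and M: "\<And>\<nu>. \<nu> \<in> types \<pi> \<Longrightarrow> mult \<pi>' (\<sigma> \<nu>) = mult \<pi> \<nu>"
  obtains \<psi>t where "regular_map (N_var \<pi>) (N_var \<pi>') \<psi>t"
    "\<And>x. f_map \<zeta> \<pi>' (\<psi>t x) = f_map \<zeta> \<pi> x"
    "\<And>x. q_hat d \<pi>' (\<psi>t x) = q_hat d \<pi> x"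
proof -
  have \<zeta>0: "\<zeta> \<noteq> 0" by (rule primitive_root_nonzero[OF \<zeta> assms(1)])
  have \<zeta>d: "(\<zeta> ^ k) ^ d = 1" for k
    by (rule primitive_root_power_power[OF \<zeta>])
  have types: "finite (types \<pi>)" "finite (types \<pi>')" using prof by (auto simp: is_profile_def)
  have rep: "\<And>\<nu>. \<nu> \<in> types \<pi> \<Longrightarrow> rep \<pi> \<nu> \<subseteq> {..<d}" "\<And>\<nu>. \<nu> \<in> types \<pi>' \<Longrightarrow> rep \<pi>' \<nu> \<subseteq> {..<d}"
    using prof by (auto simp: is_profile_def)
  have "\<exists>t. rep \<pi>' (\<sigma> \<nu>) = translate d t (rep \<pi> \<nu>)" if "\<nu> \<in> types \<pi>" for \<nu>
  proof -
    have "\<sigma> \<nu> \<in> types \<pi>'" using \<sigma> that by (auto simp: bij_betw_def)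
    from necklace_self[OF assms(1) rep(2)[OF this]] show ?thesis
      unfolding N[OF that] by (auto simp: necklace_def)
  qed
  then obtain t where t: "\<And>\<nu>. \<nu> \<in> types \<pi> \<Longrightarrow> rep \<pi>' (\<sigma> \<nu>) = translate d (t \<nu>) (rep \<pi> \<nu>)" by metis
  define inv where "inv = inv_into (types \<pi>) \<sigma>"
  have inv: "\<And>\<nu>. \<nu> \<in> types \<pi>' \<Longrightarrow> inv \<nu> \<in> types \<pi>" "\<And>\<nu>. \<nu> \<in> types \<pi>' \<Longrightarrow> \<sigma> (inv \<nu>) = \<nu>"
    "\<And>\<nu>. \<nu> \<in> types \<pi> \<Longrightarrow> inv (\<sigma> \<nu>) = \<nu>"
    using \<sigma> by (auto simp: inv_def bij_betw_def inv_into_into f_inv_into_f)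
  define z where "z = (\<lambda>\<nu>. \<zeta> ^ t \<nu>)"
  have z: "z \<nu> \<noteq> 0" "z \<nu> ^ d = 1" for \<nu> using \<zeta>0 \<zeta>d by (auto simp: z_def)
  define \<psi>t where "\<psi>t = (\<lambda>x. \<lambda>\<nu>\<in>types \<pi>'. image_mset (rot (z (inv \<nu>))) (x (inv \<nu>)))"
  have \<psi>t: "\<psi>t x (\<sigma> \<nu>) = image_mset (rot (z \<nu>)) (x \<nu>)" if "\<nu> \<in> types \<pi>" for x \<nu>
    using that inv \<sigma> by (auto simp: \<psi>t_def bij_betw_def)
  show thesis
  proof (rule that)
    fix x
    have "q_hat d \<pi>' (\<psi>t x) = (\<Sum>\<nu>\<in>types \<pi>. image_mset (power_point d) (\<psi>t x (\<sigma> \<nu>)))"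
      unfolding q_hat_def by (rule sum.reindex_bij_betw[OF \<sigma>, symmetric])
    also have "\<dots> = q_hat d \<pi> x"
      unfolding q_hat_def using z
      by (intro sum.cong) (auto simp: \<psi>t image_mset.compositionality o_def power_point_rot)
    finally show "q_hat d \<pi>' (\<psi>t x) = q_hat d \<pi> x" .
  next
    fix x
    have "(\<Prod>\<nu>\<in>types \<pi>'. \<Prod>p\<in>#\<psi>t x \<nu>. orbit_form \<zeta> (rep \<pi>' \<nu>) p) =
        (\<Prod>\<nu>\<in>types \<pi>. \<Prod>p\<in>#\<psi>t x (\<sigma> \<nu>). orbit_form \<zeta> (rep \<pi>' (\<sigma> \<nu>)) p)"
      by (rule prod.reindex_bij_betw[OF \<sigma>, symmetric])
    also have "\<dots> = (\<Prod>\<nu>\<in>types \<pi>. \<Prod>p\<in>#x \<nu>. orbit_form \<zeta> (translate d (t \<nu>) (rep \<pi> \<nu>)) (rot (z \<nu>) p))"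
      by (intro prod.cong) (auto simp: \<psi>t t image_mset.compositionality o_def)
    finally have eq: "(\<Prod>\<nu>\<in>types \<pi>'. \<Prod>p\<in>#\<psi>t x \<nu>. orbit_form \<zeta> (rep \<pi>' \<nu>) p) = \<dots>" .
    have "\<exists>c. c \<noteq> 0 \<and> (\<Prod>\<nu>\<in>types \<pi>. \<Prod>p\<in>#x \<nu>. orbit_form \<zeta> (translate d (t \<nu>) (rep \<pi> \<nu>)) (rot (z \<nu>) p)) =
        smult c (\<Prod>\<nu>\<in>types \<pi>. \<Prod>p\<in>#x \<nu>. orbit_form \<zeta> (rep \<pi> \<nu>) p)"
      unfolding z_def
      by (intro prod_smult_ex prod_mset_smult_ex orbit_form_rot[OF \<zeta> assms(1)] types rep)
    then show "f_map \<zeta> \<pi>' (\<psi>t x) = f_map \<zeta> \<pi> x"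
      unfolding f_map_def eq by (auto simp: pclass_coeff_smult)
  next
    show "regular_map (N_var \<pi>) (N_var \<pi>') \<psi>t"
      unfolding regular_map_def
    proof (intro conjI ballI)
      show "\<psi>t \<in> pts (N_var \<pi>) \<rightarrow> pts (N_var \<pi>')"
      proof
        fix x :: "'i \<Rightarrow> 'a proj multiset"
        assume x: "x \<in> pts (N_var \<pi>)"
        have "\<psi>t x \<nu> \<in> Sym_P1 (mult \<pi>' \<nu>)" if \<nu>: "\<nu> \<in> types \<pi>'" for \<nu>
        proof -
          have "x (inv \<nu>) \<in> Sym_P1 (mult \<pi>' \<nu>)"
            using x inv(1,2)[OF \<nu>] M[OF inv(1)[OF \<nu>]] by (auto simp: N_var_def PiE_iff)
          then show ?thesis
            using \<nu> rot_in_P1[OF z(1)] by (auto simp: Sym_P1_def \<psi>t_def simp del: One_nat_def)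
        qed
        then show "\<psi>t x \<in> pts (N_var \<pi>')" by (simp add: N_var_def PiE_iff \<psi>t_def)
      qed
    next
      fix x :: "'i \<Rightarrow> 'a proj multiset" and \<nu> assume x: "x \<in> pts (N_var \<pi>)" and "\<nu> \<in> idx (N_var \<pi>')"
      then have \<nu>: "\<nu> \<in> types \<pi>'" by (simp add: N_var_def)
      let ?k = "inv \<nu>"
      \<comment> \<open>The factor over \<open>\<nu>\<close> is given by globally defined forms: the coordinates of factor \<open>inv \<nu>\<close>, scaled.\<close>
      define F where "F = (\<lambda>i. Poly_Mapping.single (Poly_Mapping.single (?k, i) (1::nat)) (z ?k ^ i))"
      have F: "multihomogeneous (types \<pi>) (\<lambda>l. if l = ?k then 1 else 0) (F i)" for i
        unfolding F_def using z(1) inv(1)[OF \<nu>] by (intro coordinate_form) auto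
      have val: "form_values (N_var \<pi>) F y = (\<lambda>i. z ?k ^ i * pcoord (Sym_coord (y ?k)) i)" for y
        unfolding form_values_def F_def using z(1) inv(1)[OF \<nu>]
        by (subst coordinate_form(2)) (auto simp: N_var_def)
      have "form_values (N_var \<pi>) F x \<noteq> (\<lambda>_. 0)"
        unfolding val using z(1) pcoord_nonzero[of "Sym_coord (x ?k)"] by (auto simp: fun_eq_iff)
      moreover have "emb (N_var \<pi>') (\<psi>t y) \<nu> = pclass (form_values (N_var \<pi>) F y)"
        if "y \<in> pts (N_var \<pi>)" for y
      proof -
        have "set_mset (y ?k) \<subseteq> proj_space 1"
          using that inv(1)[OF \<nu>] unfolding N_var_def Sym_P1_def by (auto simp del: One_nat_def)
        then show ?thesis
          unfolding val using Sym_coord_rot[OF z(1)] \<nu> by (simp add: N_var_def \<psi>t_def)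
      qed
      ultimately show "\<exists>F D. (\<forall>i. multihomogeneous (idx (N_var \<pi>)) D (F i)) \<and>
          form_values (N_var \<pi>) F x \<noteq> (\<lambda>_. 0) \<and>
          (\<forall>y\<in>pts (N_var \<pi>). form_values (N_var \<pi>) F y \<noteq> (\<lambda>_. 0) \<longrightarrow>
            emb (N_var \<pi>') (\<psi>t y) \<nu> = pclass (form_values (N_var \<pi>) F y))"
        using F by (intro exI[of _ F] exI[of _ "\<lambda>l. if l = ?k then 1 else 0"]) (auto simp: N_var_def)
    qed
  qed
qed

section \<open>Relation-compatible isomorphisms and necklace types\<close>

lemma regular_map_id:
  assumes "pts (Y_var \<zeta> \<pi>) \<subseteq> pts (Y_var \<zeta> \<pi>')"
  shows "regular_map (Y_var \<zeta> \<pi>) (Y_var \<zeta> \<pi>') (\<lambda>y. y)"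
proof -
  define F where "F = (\<lambda>i::nat. Poly_Mapping.single (Poly_Mapping.single ((), i) (1::nat)) (1::'a))"
  have F: "multihomogeneous {()} (\<lambda>l. if l = () then 1 else 0) (F i)" for i
    unfolding F_def by (rule coordinate_form(1)) auto
  have val: "form_values (Y_var \<zeta> \<pi>) F y = pcoord y" for y
    unfolding form_values_def F_def by (subst coordinate_form(2)[of _ _ "{()}"]) (auto simp: Y_var_def)
  show ?thesis
    unfolding regular_map_def
  proof (intro conjI ballI)
    fix x l
    show "\<exists>F D. (\<forall>i. multihomogeneous (idx (Y_var \<zeta> \<pi>)) D (F i)) \<and>
        form_values (Y_var \<zeta> \<pi>) F x \<noteq> (\<lambda>_. 0) \<and>
        (\<forall>y\<in>pts (Y_var \<zeta> \<pi>). form_values (Y_var \<zeta> \<pi>) F y \<noteq> (\<lambda>_. 0) \<longrightarrow>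
          emb (Y_var \<zeta> \<pi>') y l = pclass (form_values (Y_var \<zeta> \<pi>) F y))"
      using F by (intro exI[of _ F] exI[of _ "\<lambda>l. if l = () then 1 else 0"])
        (auto simp: val pcoord_nonzero, auto simp: Y_var_def)
  qed (use assms in auto)
qed

theorem theorem4p4:
  fixes \<zeta> :: "'a::{alg_closed_field, field_char_0}"
    and d m :: nat
    and \<pi> :: "'i profile" and \<pi>' :: "'j profile"
  assumes "d \<ge> 2"
    and "primitive_root d \<zeta>"
    and "is_profile d m \<pi>" and "is_profile d m \<pi>'"
    and "\<exists>\<nu>\<in>types \<pi>. necklace d (rep \<pi> \<nu>) = necklace d {0}"
    and "\<exists>\<nu>\<in>types \<pi>'. necklace d (rep \<pi>' \<nu>) = necklace d {0}"
    and "\<forall>\<nu>\<in>types \<pi>. mult \<pi> \<nu> \<ge> d"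
    and "\<forall>\<nu>\<in>types \<pi>'. mult \<pi>' \<nu> \<ge> d"
  shows "(\<exists>\<psi>. relation_compatible_iso d \<zeta> \<pi> \<pi>' \<psi>) \<longleftrightarrow>
         (\<exists>\<sigma>. bij_betw \<sigma> (types \<pi>) (types \<pi>') \<and>
              (\<forall>\<nu>\<in>types \<pi>. necklace d (rep \<pi>' (\<sigma> \<nu>)) = necklace d (rep \<pi> \<nu>) \<and>
                           mult \<pi>' (\<sigma> \<nu>) = mult \<pi> \<nu>))"
proof
  have d: "d > 0" using assms(1) by simp
  have types: "finite (types \<pi>)" "finite (types \<pi>')" using assms(3,4) by (auto simp: is_profile_def)
  assume "\<exists>\<psi>. relation_compatible_iso d \<zeta> \<pi> \<pi>' \<psi>"
  then obtain \<psi> \<psi>t where reg: "regular_map (N_var \<pi>) (N_var \<pi>') \<psi>t"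
    and lift: "\<And>x. x \<in> pts (N_var \<pi>) \<Longrightarrow> f_map \<zeta> \<pi>' (\<psi>t x) = \<psi> (f_map \<zeta> \<pi> x)"
    and q: "\<And>x. x \<in> pts (N_var \<pi>) \<Longrightarrow> q_hat d \<pi>' (\<psi>t x) = q_hat d \<pi> x"
    by (auto simp: relation_compatible_iso_def is_lift_def)
  obtain \<tau> e where \<tau>: "\<tau> \<in> slots \<pi> \<rightarrow> types \<pi>'"
    and \<psi>t: "\<And>u. \<psi>t (conf \<pi> u) = config (types \<pi>') (slots \<pi>) \<tau> (\<lambda>i. \<zeta> ^ e i * u i)"
    using lift_rigid[OF assms(2) d types reg q] by blast
  have card: "card {i\<in>slots \<pi>. \<tau> i = \<nu>} = mult \<pi>' \<nu>" if "\<nu> \<in> types \<pi>'" for \<nu>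
  proof -
    have "\<psi>t (conf \<pi> (\<lambda>_. 0)) \<in> pts (N_var \<pi>')"
      using reg conf_in_N by (auto simp: regular_map_def)
    then show ?thesis unfolding \<psi>t by (rule config_in_N_card) fact
  qed
  have pos: "\<And>\<nu>. \<nu> \<in> types \<pi> \<Longrightarrow> 0 < mult \<pi> \<nu>" "\<And>\<nu>. \<nu> \<in> types \<pi>' \<Longrightarrow> 0 < mult \<pi>' \<nu>"
    using assms(3,4) by (auto simp: is_profile_def)
  have surj: "types \<pi>' \<subseteq> \<tau> ` slots \<pi>"
  proof
    fix \<nu> assume "\<nu> \<in> types \<pi>'"
    then have "card {i\<in>slots \<pi>. \<tau> i = \<nu>} > 0" using card pos(2) by simp
    then have "{i\<in>slots \<pi>. \<tau> i = \<nu>} \<noteq> {}" by (metis card.empty less_irrefl)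
    then show "\<nu> \<in> \<tau> ` slots \<pi>" by auto
  qed
  have f: "f_map \<zeta> \<pi>' (config (types \<pi>') (slots \<pi>) \<tau> (\<lambda>i. \<zeta> ^ e i * u i)) = \<psi> (f_map \<zeta> \<pi> (conf \<pi> u))" for u
    using lift[OF conf_in_N, of u] by (simp add: \<psi>t)
  obtain \<nu>0 \<nu>1 where \<nu>: "\<nu>0 \<in> types \<pi>" "necklace d (rep \<pi> \<nu>0) = necklace d {0}" "d \<le> mult \<pi> \<nu>0"
    "\<nu>1 \<in> types \<pi>'" "necklace d (rep \<pi>' \<nu>1) = necklace d {0}" using assms(5-7) by auto
  show "\<exists>\<sigma>. bij_betw \<sigma> (types \<pi>) (types \<pi>') \<and>
      (\<forall>\<nu>\<in>types \<pi>. necklace d (rep \<pi>' (\<sigma> \<nu>)) = necklace d (rep \<pi> \<nu>) \<and> mult \<pi>' (\<sigma> \<nu>) = mult \<pi> \<nu>)"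
  proof (rule profile_bijection[OF _ _ \<tau> _ card pos(1) surj])
    show "inj_on (\<lambda>\<nu>. necklace d (rep \<pi> \<nu>)) (types \<pi>)" "inj_on (\<lambda>\<nu>. necklace d (rep \<pi>' \<nu>)) (types \<pi>')"
      using assms(3,4) by (auto simp: is_profile_def)
    show "necklace d (rep \<pi>' (\<tau> i)) = necklace d (rep \<pi> (fst i))" if "i \<in> slots \<pi>" for i
      using lift_preserves_necklaces[OF d assms(2-4) \<nu> \<tau> surj f that] .
  qed
next
  have d: "d > 0" using assms(1) by simp
  assume "\<exists>\<sigma>. bij_betw \<sigma> (types \<pi>) (types \<pi>') \<and>
      (\<forall>\<nu>\<in>types \<pi>. necklace d (rep \<pi>' (\<sigma> \<nu>)) = necklace d (rep \<pi> \<nu>) \<and> mult \<pi>' (\<sigma> \<nu>) = mult \<pi> \<nu>)"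
  then obtain \<sigma> where \<sigma>: "bij_betw \<sigma> (types \<pi>) (types \<pi>')"
    "\<And>\<nu>. \<nu> \<in> types \<pi> \<Longrightarrow> necklace d (rep \<pi>' (\<sigma> \<nu>)) = necklace d (rep \<pi> \<nu>)"
    "\<And>\<nu>. \<nu> \<in> types \<pi> \<Longrightarrow> mult \<pi>' (\<sigma> \<nu>) = mult \<pi> \<nu>" by blast
  let ?\<sigma>' = "inv_into (types \<pi>) \<sigma>"
  have \<sigma>': "bij_betw ?\<sigma>' (types \<pi>') (types \<pi>)" by (rule bij_betw_inv_into[OF \<sigma>(1)])
  have inv: "?\<sigma>' \<nu> \<in> types \<pi>" "\<sigma> (?\<sigma>' \<nu>) = \<nu>" if "\<nu> \<in> types \<pi>'" for \<nu>
    using \<sigma>(1) that by (auto simp: bij_betw_def inv_into_into f_inv_into_f)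
  obtain \<psi>t where \<psi>t: "regular_map (N_var \<pi>) (N_var \<pi>') \<psi>t"
    "\<And>x. f_map \<zeta> \<pi>' (\<psi>t x) = f_map \<zeta> \<pi> x" "\<And>x. q_hat d \<pi>' (\<psi>t x) = q_hat d \<pi> x"
    using rotation_lift[OF d assms(2-4) \<sigma>] by blast
  obtain \<chi>t where \<chi>t: "regular_map (N_var \<pi>') (N_var \<pi>) \<chi>t"
    "\<And>x. f_map \<zeta> \<pi> (\<chi>t x) = f_map \<zeta> \<pi>' x"
    using rotation_lift[OF d assms(2,4,3) \<sigma>'] \<sigma>(2,3) inv by metis
  \<comment> \<open>The lifts in both directions show that \<open>Y\<^sub>\<pi>\<close> and \<open>Y\<^sub>\<pi>\<^sub>'\<close> have the same points, so that the identity serves as \<open>\<psi>\<close>.\<close>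
  have "pts (Y_var \<zeta> \<pi>) \<subseteq> pts (Y_var \<zeta> \<pi>')"
  proof
    fix y assume "y \<in> pts (Y_var \<zeta> \<pi>)"
    then obtain x where "x \<in> pts (N_var \<pi>)" "y = f_map \<zeta> \<pi> x" by (auto simp: Y_var_def)
    moreover from this have "\<psi>t x \<in> pts (N_var \<pi>')" using \<psi>t(1) by (auto simp: regular_map_def)
    ultimately show "y \<in> pts (Y_var \<zeta> \<pi>')" using \<psi>t(2) by (auto simp: Y_var_def intro!: image_eqI[of _ _ "\<psi>t x"])
  qed
  moreover have "pts (Y_var \<zeta> \<pi>') \<subseteq> pts (Y_var \<zeta> \<pi>)"
  proof
    fix y assume "y \<in> pts (Y_var \<zeta> \<pi>')"
    then obtain x where "x \<in> pts (N_var \<pi>')" "y = f_map \<zeta> \<pi>' x" by (auto simp: Y_var_def)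
    moreover from this have "\<chi>t x \<in> pts (N_var \<pi>)" using \<chi>t(1) by (auto simp: regular_map_def)
    ultimately show "y \<in> pts (Y_var \<zeta> \<pi>)" using \<chi>t(2) by (auto simp: Y_var_def intro!: image_eqI[of _ _ "\<chi>t x"])
  qed
  ultimately have "isomorphism (Y_var \<zeta> \<pi>) (Y_var \<zeta> \<pi>') (\<lambda>y. y)"
    unfolding isomorphism_def by (auto intro!: regular_map_id exI[of _ "\<lambda>y. y"])
  then have "relation_compatible_iso d \<zeta> \<pi> \<pi>' (\<lambda>y. y)"
    unfolding relation_compatible_iso_def is_lift_def using \<psi>t
    by (intro conjI exI[of _ \<psi>t] ballI) auto
  then show "\<exists>\<psi>. relation_compatible_iso d \<zeta> \<pi> \<pi>' \<psi>" by blast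
qed

end
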